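(* Let $\mathcal{X}$, $\rho$, $\mu_{\mathcal{X}}$, $k$, $\mathcal{H}$, $\mathcal{U}$, $C_X$, $\mathcal{B}$, $\mathcal{U}_N$, $\mathcal{B}_N$ and the trajectories $\hat{\mathbf{x}}_j,\hat{\mathbf{x}}_{N,j},\mathbf{x}_j,\mathbf{x}_{N,j}$ be as defined in the context. Let $c_1>0$ be a coercivity constant of $C_X$, i.e. $c_1\|\psi\|_{\mathcal{H}}\le\|C_X\psi\|_{\mathcal{H}}$ for all $\psi\in\mathcal{H}$. Let $\delta\in(0,1)$ and $N\in\mathbb{N}$ be such that $$\delta>2\exp\left(-\frac{Nc_1^2}{8\|k\|_\infty}\right).$$ If $\mathcal{U}\mathcal{H}\subseteq\mathcal{H}$ and $\mathcal{B}^*(\mathbb{R}^n)^*\subseteq\mathcal{H}$, then with probability at least $(1-\delta)^3$ (over the sample $(x_i,x_i^+)_{i=1}^N$), for each time step $j$ there is a constant $C_{\delta,j}$ (depending on $\delta$ and $j$, but not on $N$ or on the sample) such that $$\|\hat{\mathbf{x}}_{N,j}-\hat{\mathbf{x}}_j\|\le C_{\delta,j}N^{-1/2},\qquad \left\|\mathbb{E}[\mathbf{x}_{N,j}-\mathbf{x}_j]\right\|\le C_{\delta,j}N^{-1/2}.$$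
   Context: A stochastic dynamical system $\mathbf{x}_{j+1}=\mathbf{f}(\mathbf{x}_j,\mathbf{w}_j)$ on $\mathbb{R}^n$ has transition measure $\rho(\mathbf{x},\mathcal{A})=\mathbb{P}(\mathbf{f}(\mathbf{x},\cdot)\in\mathcal{A})$ for Borel $\mathcal{A}$. $\mathcal{X}\subseteq\mathbb{R}^n$ is a compact invariant space: $\rho(\mathbf{x},\mathcal{X})=1$ for all $\mathbf{x}\in\mathcal{X}$. $\mu_{\mathcal{X}}$ is a Borel probability measure on $\mathcal{X}$; $X\sim\mu_{\mathcal{X}}$, and, given $X=\mathbf{x}$, $X^+\sim\rho(\mathbf{x},\cdot)$. $k$ is a bounded measurable real positive definite kernel on $\mathcal{X}\times\mathcal{X}$; $\|k\|_\infty=\sup|k|$. $\mathcal{H}$ is its (separable) reproducing kernel Hilbert space, and $\Phi(x)=k(\cdot,x)$ is the canonical feature map, so $\psi(x)=\langle\psi,\Phi(x)\rangle_{\mathcal{H}}$. For $x,y\in\mathcal{X}$, $[\Phi(x)\otimes\Phi(y)]\psi=\psi(y)\Phi(x)$. Also let $\tilde k(x,y)=\langle x,y\rangle$ be the dot product kernel, with RKHS $\tilde{\mathcal{H}}=(\mathbb{R}^n)^*$ and feature map $\tilde\phi(x)=\langle x,\cdot\rangle$; $(\mathbb{R}^n)^*$ is identified with $\mathbb{R}^n$, so that $\tilde\phi(x)$ is identified with $x$. For $x,y\in\mathcal{X}$, $[\tilde\phi(x)\otimes\Phi(y)]\psi=\psi(y)\tilde\phi(x)$, an operator $\mathcal{H}\to\tilde{\mathcal{H}}$.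 Operators: $C_X=\mathbb{E}[\Phi(X)\otimes\Phi(X)]:\mathcal{H}\to\mathcal{H}$; $C_{XX}=\mathbb{E}[\tilde\phi(X)\otimes\Phi(X)]:\mathcal{H}\to\tilde{\mathcal{H}}$; the lifting-back operator is $\mathcal{B}=C_{XX}C_X^{-1}:\mathcal{H}\to\tilde{\mathcal{H}}\cong\mathbb{R}^n$. The Koopman operator is $(\mathcal{U}\psi)(\mathbf{x})=\int_{\mathcal{X}}\psi(x')\rho(\mathbf{x},dx')$, and its adjoint $\mathcal{U}^*$ on $\mathcal{H}$ is also denoted $C_{X^+|X}$; it satisfies $C_{X^+|X}\Phi(\mathbf{x})=\mathbb{E}[\Phi(X^+)\mid X=\mathbf{x}]$. Sample and empirical operators: $x_1,\dots,x_N$ are i.i.d. with law $\mu_{\mathcal{X}}$ and $x_i^+\sim\rho(x_i,\cdot)$, so that the pairs $(x_i,x_i^+)$ are i.i.d. copies of $(X,X^+)$. Put $\mathcal{H}_N=\mathrm{span}\{\Phi(x_i)\}_{i=1}^N$ and $$C_X^N=\frac1N\sum_{i=1}^N\Phi(x_i)\otimes\Phi(x_i),\quad C_{XX^+}^N=\frac1N\sum_{i=1}^N\Phi(x_i)\otimes\Phi(x_i^+),\quad C_{XX}^N=\frac1N\sum_{i=1}^N\tilde\phi(x_i)\otimes\Phi(x_i).$$ $(C_X^N)^{-1}$ denotes the inverse of the bijection $C_X^N|_{\mathcal{H}_N}:\mathcal{H}_N\to\mathcal{H}_N$, precomposed with the orthogonal projection onto $\mathcal{H}_N$ when applied to elements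 of $\mathcal{H}$. Set $\mathcal{U}_N=(C_X^N)^{-1}C_{XX^+}^N:\mathcal{H}\to\mathcal{H}$ and $\mathcal{B}_N=C_{XX}^N(C_X^N)^{-1}:\mathcal{H}\to\tilde{\mathcal{H}}\cong\mathbb{R}^n$. Trajectories, for a fixed initial state $\mathbf{x}_0\in\mathcal{X}$: - Mean trajectory: $\hat\mu_0=\Phi(\mathbf{x}_0)$, $\hat\mu_{j+1}=\mathcal{U}^*\hat\mu_j$, $\hat{\mathbf{x}}_j=\mathcal{B}\hat\mu_j$. - Approximate mean trajectory: $\hat\mu_{N,0}=\Phi(\mathbf{x}_0)$, $\hat\mu_{N,j+1}=\mathcal{U}_N^*\hat\mu_{N,j}$, $\hat{\mathbf{x}}_{N,j}=\mathcal{B}_N\hat\mu_{N,j}$. - Stochastic trajectory: $(\mathbf{x}_j)$ is a trajectory of the system. Its embedding $\mu_j=\Phi(\mathbf{x}_j)$ satisfies $\mu_{j+1}=\mathcal{U}^*\mu_j+\zeta_j$ with $\zeta_j=\Phi(\mathbf{x}_{j+1})-C_{X^+|X}\Phi(\mathbf{x}_j)$. - Approximate stochastic trajectory: $\mu_{N,0}=\Phi(\mathbf{x}_0)$, $\mu_{N,j+1}=\mathcal{U}_N^*\mu_{N,j}+\hat\zeta_{N,j}$, $\mathbf{x}_{N,j}=\mathcal{B}_N\mu_{N,j}$, where $$\hat\zeta_{N,j}=\frac1{N_\zeta}\sum_{i=1}^{N_\zeta}\left(\Phi(\mathbf{f}(\mathbf{x}_{N,j},\mathbf{w}_j^i))-C_{X^+|X}\Phi(\mathbf{x}_{N,j})\right),$$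 $N_\zeta\in\mathbb{N}$ is fixed and the $\mathbf{w}_j^i$ are independent realizations of the noise of the dynamics at step $j$. It is presupposed that $\mathbf{x}_{N,j}\in\mathcal{X}$, so that these expressions make sense. The expectation $\mathbb{E}$ in the claim is over the noise of the trajectories, for a fixed sample $(x_i,x_i^+)_{i=1}^N$.
   Formalization: The condition B*(R^n)* ⊆ H is taken to mean that the restrictions to X of all linear functionals lie in H; read with B* as the Hilbert-space adjoint of C_XX C_X^{-1} it is void and the second bound fails (X=[0,1], k=1, f(x,w)=x, x_0 ≠ E X). *)

theory Defs
  imports "HOL-Probability.Probability"
begin

text \<open>
  Real functions on a set \<open>X\<close> are encoded as total functions that vanish outside \<open>X\<close>.
\<close>

definition zero_ext :: "'a set \<Rightarrow> ('a \<Rightarrow> real) \<Rightarrow> 'a \<Rightarrow> real" where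
  "zero_ext X g = (\<lambda>x. if x \<in> X then g x else 0)"


section \<open>Kernels and reproducing kernel Hilbert spaces\<close>

definition pos_def_kernel :: "'a set \<Rightarrow> ('a \<Rightarrow> 'a \<Rightarrow> real) \<Rightarrow> bool" where
  "pos_def_kernel X k \<longleftrightarrow>
     (\<forall>x\<in>X. \<forall>y\<in>X. k x y = k y x) \<and>
     (\<forall>F c. finite F \<and> F \<subseteq> X \<longrightarrow> 0 \<le> (\<Sum>x\<in>F. \<Sum>y\<in>F. c x * c y * k x y))"

definition kernel_sup :: "'a set \<Rightarrow> ('a \<Rightarrow> 'a \<Rightarrow> real) \<Rightarrow> real" where
  "kernel_sup X k = (SUP p\<in>X \<times> X. \<bar>k (fst p) (snd p)\<bar>)"

text \<open>
  The RKHS of \<open>k\<close> is the function space \<open>range evl\<close>: the type \<open>'h\<close> carries its Hilbert space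
  structure, and the linear injection \<open>evl\<close> sends an element of \<open>'h\<close> to the function on \<open>X\<close> that
  it is. The last conjunct says that \<open>k(\<cdot>,x)\<close> is a member and has the reproducing property.
  Completeness and separability are the type classes of \<open>'h\<close>.
\<close>

definition rkhs ::
  "'a set \<Rightarrow> ('a \<Rightarrow> 'a \<Rightarrow> real) \<Rightarrow>
   ('h::{real_inner, banach, second_countable_topology} \<Rightarrow> 'a \<Rightarrow> real) \<Rightarrow> bool" where
  "rkhs X k evl \<longleftrightarrow>
     inj evl \<and>
     (\<forall>\<psi> x. x \<notin> X \<longrightarrow> evl \<psi> x = 0) \<and>
     (\<forall>a b \<psi> \<phi> x. evl (a *\<^sub>R \<psi> + b *\<^sub>R \<phi>) x = a * evl \<psi> x + b * evl \<phi> x) \<and>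
     (\<forall>x\<in>X. \<exists>\<phi>. evl \<phi> = zero_ext X (\<lambda>y. k y x) \<and> (\<forall>\<psi>. evl \<psi> x = \<psi> \<bullet> \<phi>))"

text \<open>The canonical feature map, set to zero outside \<open>X\<close>, so that it stays Borel measurable.\<close>

definition feature ::
  "'a set \<Rightarrow> ('a \<Rightarrow> 'a \<Rightarrow> real) \<Rightarrow> ('h::real_vector \<Rightarrow> 'a \<Rightarrow> real) \<Rightarrow> 'a \<Rightarrow> 'h" where
  "feature X k evl x = (if x \<in> X then inv evl (zero_ext X (\<lambda>y. k y x)) else 0)"

text \<open>The rank-one operator \<open>u \<otimes> \<Phi>(y)\<close>, that is \<open>\<psi> \<mapsto> \<psi>(y) u\<close>.\<close>

definition tensor_feature ::
  "('h \<Rightarrow> 'a \<Rightarrow> real) \<Rightarrow> 'b::real_vector \<Rightarrow> 'a \<Rightarrow> 'h \<Rightarrow> 'b" where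
  "tensor_feature evl u y \<psi> = evl \<psi> y *\<^sub>R u"


section \<open>The dynamics and the Koopman operator\<close>

text \<open>\<open>\<nu>\<close> is the law of the noise \<open>w\<^sub>j\<close>.\<close>

definition transition ::
  "'w measure \<Rightarrow> ('a::topological_space \<Rightarrow> 'w \<Rightarrow> 'a) \<Rightarrow> 'a \<Rightarrow> 'a measure" where
  "transition \<nu> f x = distr \<nu> borel (f x)"

definition koopman_fun ::
  "'a set \<Rightarrow> 'w measure \<Rightarrow> ('a::topological_space \<Rightarrow> 'w \<Rightarrow> 'a) \<Rightarrow> ('a \<Rightarrow> real) \<Rightarrow> 'a \<Rightarrow> real" where
  "koopman_fun X \<nu> f g = zero_ext X (\<lambda>x. LINT x':X|transition \<nu> f x. g x')"

definition koopman ::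
  "'a set \<Rightarrow> ('h \<Rightarrow> 'a \<Rightarrow> real) \<Rightarrow> 'w measure \<Rightarrow> ('a::topological_space \<Rightarrow> 'w \<Rightarrow> 'a) \<Rightarrow> 'h \<Rightarrow> 'h" where
  "koopman X evl \<nu> f \<psi> = inv evl (koopman_fun X \<nu> f (evl \<psi>))"

text \<open>The operator \<open>U\<^sup>*\<close>, also written \<open>C\<close> with index \<open>X\<^sup>+|X\<close>.\<close>

definition koopman_adj ::
  "'a set \<Rightarrow> ('h::real_inner \<Rightarrow> 'a \<Rightarrow> real) \<Rightarrow> 'w measure \<Rightarrow>
   ('a::topological_space \<Rightarrow> 'w \<Rightarrow> 'a) \<Rightarrow> 'h \<Rightarrow> 'h" where
  "koopman_adj X evl \<nu> f = adjoint (koopman X evl \<nu> f)"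


section \<open>Covariance operators and the lifting-back operator\<close>

text \<open>The expectations of rank-one operators are taken pointwise on the Hilbert space.\<close>

definition cov ::
  "'a set \<Rightarrow> ('a \<Rightarrow> 'a \<Rightarrow> real) \<Rightarrow> ('h::{real_inner, banach, second_countable_topology} \<Rightarrow> 'a \<Rightarrow> real) \<Rightarrow>
   'a measure \<Rightarrow> 'h \<Rightarrow> 'h" where
  "cov X k evl \<mu> \<psi> = (LINT x|\<mu>. tensor_feature evl (feature X k evl x) x \<psi>)"

definition cov_id ::
  "('h \<Rightarrow> 'a::euclidean_space \<Rightarrow> real) \<Rightarrow> 'a measure \<Rightarrow> 'h \<Rightarrow> 'a" where
  "cov_id evl \<mu> \<psi> = (LINT x|\<mu>. tensor_feature evl x x \<psi>)"

definition lift_back ::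
  "'a set \<Rightarrow> ('a \<Rightarrow> 'a \<Rightarrow> real) \<Rightarrow>
   ('h::{real_inner, banach, second_countable_topology} \<Rightarrow> 'a::euclidean_space \<Rightarrow> real) \<Rightarrow>
   'a measure \<Rightarrow> 'h \<Rightarrow> 'a" where
  "lift_back X k evl \<mu> = cov_id evl \<mu> \<circ> inv (cov X k evl \<mu>)"

text \<open>
  The function-space form of \<open>B\<^sup>*\<close>, the analogue of \<open>koopman_fun\<close>: where \<open>U\<close> maps \<open>g\<close> to
  \<open>x \<mapsto> E[g(X\<^sup>+) | X = x]\<close>, \<open>B\<^sup>*\<close> maps the linear functional \<open>\<langle>v, \<cdot>\<rangle>\<close> to
  \<open>x \<mapsto> E[\<langle>v, X\<rangle> | X = x]\<close>, i.e. to its restriction to \<open>X\<close>. As for \<open>U\<close>, membership of the values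
  in the RKHS is a condition and not automatic.
\<close>

definition lift_back_adj_fun :: "'a set \<Rightarrow> 'a::real_inner \<Rightarrow> 'a \<Rightarrow> real" where
  "lift_back_adj_fun X v = zero_ext X (\<lambda>x. v \<bullet> x)"


section \<open>Empirical operators\<close>

text \<open>A sample \<open>z\<close> consists of the pairs \<open>z i = (x\<^sub>i, x\<^sub>i\<^sup>+)\<close>, of which those with \<open>i < N\<close> are used.\<close>

definition sample_law ::
  "'w measure \<Rightarrow> ('a::topological_space \<Rightarrow> 'w \<Rightarrow> 'a) \<Rightarrow> 'a measure \<Rightarrow> ('a \<times> 'a) measure" where
  "sample_law \<nu> f \<mu> = \<mu> \<bind> (\<lambda>x. distr (transition \<nu> f x) borel (\<lambda>x'. (x, x')))"

definition emp_space ::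
  "'a set \<Rightarrow> ('a \<Rightarrow> 'a \<Rightarrow> real) \<Rightarrow> ('h::real_vector \<Rightarrow> 'a \<Rightarrow> real) \<Rightarrow> nat \<Rightarrow> (nat \<Rightarrow> 'a \<times> 'a) \<Rightarrow> 'h set" where
  "emp_space X k evl N z = span ((\<lambda>i. feature X k evl (fst (z i))) ` {..<N})"

definition emp_cov ::
  "'a set \<Rightarrow> ('a \<Rightarrow> 'a \<Rightarrow> real) \<Rightarrow> ('h::real_vector \<Rightarrow> 'a \<Rightarrow> real) \<Rightarrow> nat \<Rightarrow> (nat \<Rightarrow> 'a \<times> 'a) \<Rightarrow> 'h \<Rightarrow> 'h" where
  "emp_cov X k evl N z \<psi> =
     (1 / real N) *\<^sub>R (\<Sum>i<N. tensor_feature evl (feature X k evl (fst (z i))) (fst (z i)) \<psi>)"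

definition emp_cross_cov ::
  "'a set \<Rightarrow> ('a \<Rightarrow> 'a \<Rightarrow> real) \<Rightarrow> ('h::real_vector \<Rightarrow> 'a \<Rightarrow> real) \<Rightarrow> nat \<Rightarrow> (nat \<Rightarrow> 'a \<times> 'a) \<Rightarrow> 'h \<Rightarrow> 'h" where
  "emp_cross_cov X k evl N z \<psi> =
     (1 / real N) *\<^sub>R (\<Sum>i<N. tensor_feature evl (feature X k evl (fst (z i))) (snd (z i)) \<psi>)"

definition emp_cov_id ::
  "('h \<Rightarrow> 'a::real_vector \<Rightarrow> real) \<Rightarrow> nat \<Rightarrow> (nat \<Rightarrow> 'a \<times> 'a) \<Rightarrow> 'h \<Rightarrow> 'a" where
  "emp_cov_id evl N z \<psi> =
     (1 / real N) *\<^sub>R (\<Sum>i<N. tensor_feature evl (fst (z i)) (fst (z i)) \<psi>)"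

definition orth_proj :: "'h::real_inner set \<Rightarrow> 'h \<Rightarrow> 'h" where
  "orth_proj V \<psi> = (THE p. p \<in> V \<and> (\<forall>v\<in>V. (\<psi> - p) \<bullet> v = 0))"

definition emp_cov_inv ::
  "'a set \<Rightarrow> ('a \<Rightarrow> 'a \<Rightarrow> real) \<Rightarrow> ('h::real_inner \<Rightarrow> 'a \<Rightarrow> real) \<Rightarrow> nat \<Rightarrow> (nat \<Rightarrow> 'a \<times> 'a) \<Rightarrow> 'h \<Rightarrow> 'h" where
  "emp_cov_inv X k evl N z \<psi> =
     inv_into (emp_space X k evl N z) (emp_cov X k evl N z) (orth_proj (emp_space X k evl N z) \<psi>)"

definition emp_koopman ::
  "'a set \<Rightarrow> ('a \<Rightarrow> 'a \<Rightarrow> real) \<Rightarrow> ('h::real_inner \<Rightarrow> 'a \<Rightarrow> real) \<Rightarrow> nat \<Rightarrow> (nat \<Rightarrow> 'a \<times> 'a) \<Rightarrow> 'h \<Rightarrow> 'h" where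
  "emp_koopman X k evl N z = emp_cov_inv X k evl N z \<circ> emp_cross_cov X k evl N z"

definition emp_lift_back ::
  "'a set \<Rightarrow> ('a \<Rightarrow> 'a \<Rightarrow> real) \<Rightarrow> ('h::real_inner \<Rightarrow> 'a::real_vector \<Rightarrow> real) \<Rightarrow> nat \<Rightarrow>
   (nat \<Rightarrow> 'a \<times> 'a) \<Rightarrow> 'h \<Rightarrow> 'a" where
  "emp_lift_back X k evl N z = emp_cov_id evl N z \<circ> emp_cov_inv X k evl N z"


section \<open>Trajectories\<close>

definition mean_traj ::
  "'a set \<Rightarrow> ('a \<Rightarrow> 'a \<Rightarrow> real) \<Rightarrow>
   ('h::{real_inner, banach, second_countable_topology} \<Rightarrow> 'a::euclidean_space \<Rightarrow> real) \<Rightarrow>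
   'w measure \<Rightarrow> ('a \<Rightarrow> 'w \<Rightarrow> 'a) \<Rightarrow> 'a measure \<Rightarrow> 'a \<Rightarrow> nat \<Rightarrow> 'a" where
  "mean_traj X k evl \<nu> f \<mu> x0 j =
     lift_back X k evl \<mu> ((koopman_adj X evl \<nu> f ^^ j) (feature X k evl x0))"

definition approx_mean_traj ::
  "'a set \<Rightarrow> ('a \<Rightarrow> 'a \<Rightarrow> real) \<Rightarrow> ('h::real_inner \<Rightarrow> 'a::real_vector \<Rightarrow> real) \<Rightarrow>
   nat \<Rightarrow> (nat \<Rightarrow> 'a \<times> 'a) \<Rightarrow> 'a \<Rightarrow> nat \<Rightarrow> 'a" where
  "approx_mean_traj X k evl N z x0 j =
     emp_lift_back X k evl N z ((adjoint (emp_koopman X k evl N z) ^^ j) (feature X k evl x0))"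

primrec traj :: "('a \<Rightarrow> 'w \<Rightarrow> 'a) \<Rightarrow> 'a \<Rightarrow> (nat \<Rightarrow> 'w) \<Rightarrow> nat \<Rightarrow> 'a" where
  "traj f x0 w 0 = x0"
| "traj f x0 w (Suc j) = f (traj f x0 w j) (w j)"

text \<open>\<open>wz j i\<close>, \<open>i < Nz\<close>, are the noise realizations of step \<open>j\<close>.\<close>

definition approx_noise ::
  "'a set \<Rightarrow> ('a \<Rightarrow> 'a \<Rightarrow> real) \<Rightarrow> ('h::real_inner \<Rightarrow> 'a::topological_space \<Rightarrow> real) \<Rightarrow>
   'w measure \<Rightarrow> ('a \<Rightarrow> 'w \<Rightarrow> 'a) \<Rightarrow> nat \<Rightarrow> (nat \<Rightarrow> 'w) \<Rightarrow> 'a \<Rightarrow> 'h" where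
  "approx_noise X k evl \<nu> f Nz w x =
     (1 / real Nz) *\<^sub>R (\<Sum>i<Nz. feature X k evl (f x (w i)) - koopman_adj X evl \<nu> f (feature X k evl x))"

primrec approx_emb ::
  "'a set \<Rightarrow> ('a \<Rightarrow> 'a \<Rightarrow> real) \<Rightarrow> ('h::real_inner \<Rightarrow> 'a::real_normed_vector \<Rightarrow> real) \<Rightarrow>
   'w measure \<Rightarrow> ('a \<Rightarrow> 'w \<Rightarrow> 'a) \<Rightarrow> nat \<Rightarrow> (nat \<Rightarrow> 'a \<times> 'a) \<Rightarrow> 'a \<Rightarrow> nat \<Rightarrow>
   (nat \<Rightarrow> nat \<Rightarrow> 'w) \<Rightarrow> nat \<Rightarrow> 'h" where
  "approx_emb X k evl \<nu> f N z x0 Nz wz 0 = feature X k evl x0"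
| "approx_emb X k evl \<nu> f N z x0 Nz wz (Suc j) =
     adjoint (emp_koopman X k evl N z) (approx_emb X k evl \<nu> f N z x0 Nz wz j)
     + approx_noise X k evl \<nu> f Nz (wz j)
         (emp_lift_back X k evl N z (approx_emb X k evl \<nu> f N z x0 Nz wz j))"

definition approx_traj ::
  "'a set \<Rightarrow> ('a \<Rightarrow> 'a \<Rightarrow> real) \<Rightarrow> ('h::real_inner \<Rightarrow> 'a::real_normed_vector \<Rightarrow> real) \<Rightarrow>
   'w measure \<Rightarrow> ('a \<Rightarrow> 'w \<Rightarrow> 'a) \<Rightarrow> nat \<Rightarrow> (nat \<Rightarrow> 'a \<times> 'a) \<Rightarrow> 'a \<Rightarrow> nat \<Rightarrow>
   (nat \<Rightarrow> nat \<Rightarrow> 'w) \<Rightarrow> nat \<Rightarrow> 'a" where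
  "approx_traj X k evl \<nu> f N z x0 Nz wz j =
     emp_lift_back X k evl N z (approx_emb X k evl \<nu> f N z x0 Nz wz j)"

end

theory Submission
  imports Defs
begin

text \<open>
  The covariance operator \<open>C\<close> is a positive operator of trace at most \<open>sup k(x,x)\<close>. A coercive trace
  class operator lives on a finite-dimensional space, so the RKHS has a finite orthonormal basis
  (\<open>card_orthonormal_bound\<close>, \<open>ex_finite_onb\<close>). Operators become matrices: every linear map is
  bounded and has an adjoint, and an operator norm is controlled by finitely many matrix entries.

  The matrix entries of \<open>C\<^sup>N - C\<close> and of \<open>C\<^sub>X\<^sub>X\<^sub>+\<^sup>N - C\<^sup>N U\<close> are averages of \<open>N\<close> independent bounded
  centred random variables, hence of order \<open>N\<^sup>-\<^sup>1\<^sup>/\<^sup>2\<close> with high probability by Hoeffding's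
  inequality. For large \<open>N\<close> this makes \<open>C\<^sup>N\<close> coercive. Then \<open>H\<^sub>N\<close> is the whole space, \<open>B\<^sub>N = B\<close>
  exactly, because \<open>B\<^sup>* v\<close> is the function \<open>\<langle>v, \<cdot>\<rangle>\<close> and both operators reproduce it, and
  \<open>U\<^sub>N - U = (C\<^sup>N)\<^sup>-\<^sup>1 (C\<^sub>X\<^sub>X\<^sub>+\<^sup>N - C\<^sup>N U)\<close> is of order \<open>N\<^sup>-\<^sup>1\<^sup>/\<^sup>2\<close> (\<open>good_sample_large\<close>).

  Below this range \<open>C\<^sup>N\<close> may fail to be injective, and its smallest nonzero eigenvalue can be
  arbitrarily close to zero, so \<open>U\<^sub>N\<close> has no deterministic bound. But that eigenvalue is positive for
  every sample, so for each fixed \<open>N\<close> it is bounded away from zero on an event of probability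
  arbitrarily close to one (\<open>emp_cov_lower_bound_tight\<close>), and the finitely many remaining values of
  \<open>N\<close> are absorbed into the constant (\<open>good_sample_uniform\<close>).

  For the trajectories, the error \<open>U\<^sub>N - U\<close> propagates through the \<open>j\<close>-fold product by telescoping
  (\<open>approx_mean_traj_error\<close>). The stochastic trajectories reduce to the mean trajectories: the noise
  of each step is independent of the past and centred given the past, so the expectations of the
  stochastic trajectories are the mean trajectories (\<open>traj_mean\<close>, \<open>approx_traj_expectation\<close>).
\<close>

section \<open>Finite orthonormal systems\<close>

definition orthonormal :: "'h::real_inner set \<Rightarrow> bool" where
  "orthonormal F \<longleftrightarrow> finite F \<and> (\<forall>a\<in>F. \<forall>b\<in>F. a \<bullet> b = (if a = b then 1 else 0))"

lemma orthonormal_inner_sum: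
  assumes "orthonormal F" "b \<in> F"
  shows "(\<Sum>a\<in>F. c a *\<^sub>R a) \<bullet> b = c b"
proof -
  have "(\<Sum>a\<in>F. c a *\<^sub>R a) \<bullet> b = (\<Sum>a\<in>F. if a = b then c a else 0)"
    unfolding inner_sum_left using assms
    by (intro sum.cong) (auto simp: orthonormal_def)
  then show ?thesis
    using assms by (simp add: orthonormal_def)
qed

lemma orthonormal_expand:
  assumes "orthonormal F" "x \<in> span F"
  shows "(\<Sum>b\<in>F. (x \<bullet> b) *\<^sub>R b) = x"
proof -
  from assms obtain c where c: "x = (\<Sum>a\<in>F. c a *\<^sub>R a)"
    unfolding orthonormal_def by (auto simp: span_finite)
  have "x \<bullet> b = c b" if "b \<in> F" for b
    unfolding c using orthonormal_inner_sum[OF assms(1) that] .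
  then have "(\<Sum>b\<in>F. (x \<bullet> b) *\<^sub>R b) = (\<Sum>b\<in>F. c b *\<^sub>R b)"
    by (intro sum.cong) auto
  then show ?thesis
    using c by simp
qed

lemma orthonormal_residual:
  assumes "orthonormal F" "v \<in> span F"
  shows "(x - (\<Sum>b\<in>F. (x \<bullet> b) *\<^sub>R b)) \<bullet> v = 0"
proof -
  have "(x - (\<Sum>b\<in>F. (x \<bullet> b) *\<^sub>R b)) \<bullet> b = 0" if "b \<in> F" for b
    using orthonormal_inner_sum[OF assms(1) that] by (simp add: inner_diff_left)
  then have "(x - (\<Sum>b\<in>F. (x \<bullet> b) *\<^sub>R b)) \<bullet> (\<Sum>b\<in>F. (v \<bullet> b) *\<^sub>R b) = 0"
    by (simp add: inner_sum_right)
  then show ?thesis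
    using orthonormal_expand[OF assms] by simp
qed

lemma orthonormal_parseval:
  assumes "orthonormal F" "x \<in> span F"
  shows "x \<bullet> y = (\<Sum>b\<in>F. (x \<bullet> b) * (y \<bullet> b))"
proof -
  have "x \<bullet> y = (\<Sum>b\<in>F. (x \<bullet> b) *\<^sub>R b) \<bullet> y"
    using orthonormal_expand[OF assms] by simp
  also have "\<dots> = (\<Sum>b\<in>F. (x \<bullet> b) * (y \<bullet> b))"
    unfolding inner_sum_left by (simp add: inner_commute)
  finally show ?thesis .
qed

lemma orthonormal_bessel:
  assumes "orthonormal F"
  shows "(\<Sum>b\<in>F. (x \<bullet> b)\<^sup>2) \<le> (norm x)\<^sup>2"
proof -
  define p where "p = (\<Sum>b\<in>F. (x \<bullet> b) *\<^sub>R b)"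
  have p: "p \<in> span F"
    unfolding p_def by (intro span_sum span_scale span_base)
  have xp: "(x - p) \<bullet> p = 0"
    using orthonormal_residual[OF assms p, of x] by (simp add: p_def)
  have "p \<bullet> b = x \<bullet> b" if "b \<in> F" for b
    unfolding p_def using orthonormal_inner_sum[OF assms that] .
  then have "p \<bullet> p = (\<Sum>b\<in>F. (x \<bullet> b)\<^sup>2)"
    using orthonormal_parseval[OF assms p, of p] by (simp add: power2_eq_square)
  moreover have "(norm x)\<^sup>2 = p \<bullet> p + (x - p) \<bullet> (x - p)"
    using xp by (simp add: power2_norm_eq_inner inner_diff_left inner_diff_right inner_commute)
  ultimately show ?thesis
    by simp
qed

text \<open>Gram--Schmidt: a maximal orthonormal system of a subspace spans it, because the normalised
  residual of a vector outside the span would enlarge the system.\<close>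

lemma ex_orthonormal_basis:
  fixes V :: "'h::real_inner set"
  assumes V: "subspace V"
    and bound: "\<And>F. orthonormal F \<Longrightarrow> F \<subseteq> V \<Longrightarrow> card F \<le> m"
  obtains F where "orthonormal F" "span F = V"
proof -
  define P where "P n \<longleftrightarrow> (\<exists>F\<subseteq>V. orthonormal F \<and> card F = n)" for n
  have P0: "P 0"
    unfolding P_def by (auto simp: orthonormal_def intro!: exI[of _ "{}"])
  have Pm: "\<And>n. P n \<Longrightarrow> n \<le> m"
    unfolding P_def using bound by blast
  define n where "n = Greatest P"
  have "P n"
    unfolding n_def by (rule GreatestI_nat[where P = P, OF P0]) (rule Pm)
  then obtain F where F: "F \<subseteq> V" "orthonormal F" "card F = n"
    unfolding P_def by auto
  have "V \<subseteq> span F"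
  proof
    fix x assume x: "x \<in> V"
    define r where "r = x - (\<Sum>b\<in>F. (x \<bullet> b) *\<^sub>R b)"
    have sumF: "(\<Sum>b\<in>F. (x \<bullet> b) *\<^sub>R b) \<in> span F"
      by (intro span_sum span_scale span_base)
    show "x \<in> span F"
    proof (rule ccontr)
      assume "x \<notin> span F"
      then have r0: "r \<noteq> 0"
        using sumF by (auto simp: r_def)
      define u where "u = r /\<^sub>R norm r"
      have "(\<Sum>b\<in>F. (x \<bullet> b) *\<^sub>R b) \<in> V"
        using F(1) by (intro subspace_sum subspace_scale V) auto
      then have uV: "u \<in> V"
        unfolding u_def r_def by (intro subspace_scale subspace_diff V x)
      have ub: "u \<bullet> b = 0" if "b \<in> F" for b
        using orthonormal_residual[OF F(2) span_base[OF that], of x]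
        by (simp add: u_def r_def)
      have uu: "u \<bullet> u = 1"
        using r0 by (simp add: u_def dot_square_norm power2_eq_square)
      have "u \<notin> F"
        using ub uu by force
      have "orthonormal (insert u F)"
        using F(2) ub uu \<open>u \<notin> F\<close> unfolding orthonormal_def
        by (auto simp: inner_commute)
      moreover have "card (insert u F) = Suc n"
        using F \<open>u \<notin> F\<close> by (simp add: orthonormal_def)
      ultimately have "P (Suc n)"
        unfolding P_def using F(1) uV by (intro exI[of _ "insert u F"]) auto
      then have "Suc n \<le> n"
        unfolding n_def by (rule Greatest_le_nat) (rule Pm)
      then show False by simp
    qed
  qed
  moreover have "span F \<subseteq> V"
    using F(1) V by (simp add: span_minimal)
  ultimately show ?thesis
    using that F(2) by blast
qed

section \<open>Finite-dimensional inner product spaces\<close>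

text \<open>The Hilbert space of the theorem is finite-dimensional for a reason that only emerges in
  its proof, so it is an arbitrary type here and the basis is a parameter.\<close>

locale finite_onb =
  fixes E :: "'h::real_inner set"
  assumes onb: "orthonormal E" and span_onb: "span E = UNIV"
begin

lemma finite_E [simp]: "finite E"
  using onb by (simp add: orthonormal_def)

lemma expand: "(\<Sum>b\<in>E. (x \<bullet> b) *\<^sub>R b) = x"
  using orthonormal_expand[OF onb] span_onb by simp

lemma parseval: "x \<bullet> y = (\<Sum>b\<in>E. (x \<bullet> b) * (y \<bullet> b))"
  by (rule orthonormal_parseval[OF onb]) (simp add: span_onb)

lemma norm_E: "b \<in> E \<Longrightarrow> norm b = 1"
  using onb by (simp add: orthonormal_def norm_eq_1)

lemma linear_expand:
  assumes "linear T"
  shows "T x = (\<Sum>b\<in>E. (x \<bullet> b) *\<^sub>R T b)"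
proof -
  have "T x = T (\<Sum>b\<in>E. (x \<bullet> b) *\<^sub>R b)"
    by (simp add: expand)
  also have "\<dots> = (\<Sum>b\<in>E. (x \<bullet> b) *\<^sub>R T b)"
    by (simp add: linear_sum[OF assms] linear_scale[OF assms])
  finally show ?thesis .
qed

lemma linear_norm_bound:
  fixes T :: "'h \<Rightarrow> 'b::real_normed_vector"
  assumes "linear T" "\<And>b. b \<in> E \<Longrightarrow> norm (T b) \<le> c"
  shows "norm (T x) \<le> (real (card E) * c) * norm x"
proof -
  have "norm (T x) \<le> (\<Sum>b\<in>E. norm ((x \<bullet> b) *\<^sub>R T b))"
    by (subst linear_expand[OF assms(1)]) (rule norm_sum)
  also have "\<dots> \<le> (\<Sum>b\<in>E. norm x * c)"
  proof (rule sum_mono)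
    fix b assume b: "b \<in> E"
    have "\<bar>x \<bullet> b\<bar> \<le> norm x"
      using Cauchy_Schwarz_ineq2[of x b] norm_E[OF b] by simp
    then show "norm ((x \<bullet> b) *\<^sub>R T b) \<le> norm x * c"
      using assms(2)[OF b] by (auto intro!: mult_mono)
  qed
  finally show ?thesis
    by (simp add: mult_ac)
qed

lemma linear_bounded_ex:
  fixes T :: "'h \<Rightarrow> 'b::real_normed_vector"
  assumes "linear T"
  obtains c where "c \<ge> 0" "\<And>x. norm (T x) \<le> c * norm x"
proof
  show "0 \<le> real (card E) * (\<Sum>b\<in>E. norm (T b))"
    by (intro mult_nonneg_nonneg sum_nonneg) auto
  show "norm (T x) \<le> (real (card E) * (\<Sum>b\<in>E. norm (T b))) * norm x" for x
    by (rule linear_norm_bound[OF assms]) (auto intro: member_le_sum)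
qed

text \<open>This and \<open>linear_norm_bound\<close> are crude, with factors equal to the dimension, which suffices
  because the dimension is a constant of the problem.\<close>

lemma norm_le_of_coords:
  assumes "\<And>b. b \<in> E \<Longrightarrow> \<bar>x \<bullet> b\<bar> \<le> c"
  shows "norm x \<le> real (card E) * c"
proof -
  have "norm x \<le> (\<Sum>b\<in>E. norm ((x \<bullet> b) *\<^sub>R b))"
    by (subst expand[symmetric]) (rule norm_sum)
  also have "\<dots> \<le> (\<Sum>b\<in>E. c)"
    using assms norm_E by (intro sum_mono) simp
  finally show ?thesis by simp
qed

lemma adjoint_inner:
  fixes T :: "'h \<Rightarrow> 'b::real_inner"
  assumes "linear T"
  shows "T x \<bullet> y = x \<bullet> adjoint T y"
proof -
  have "\<forall>x y. T x \<bullet> y = x \<bullet> (\<Sum>b\<in>E. (T b \<bullet> y) *\<^sub>R b)"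
    by (subst linear_expand[OF assms]) (simp add: inner_sum_left inner_sum_right mult.commute)
  then have "\<exists>g. \<forall>x y. T x \<bullet> y = x \<bullet> g y"
    by (intro exI[of _ "\<lambda>y. \<Sum>b\<in>E. (T b \<bullet> y) *\<^sub>R b"])
  then show ?thesis
    unfolding adjoint_def by (rule someI2_ex) blast
qed

lemma adjoint_norm_le:
  fixes T :: "'h \<Rightarrow> 'h"
  assumes "linear T" "\<And>x. norm (T x) \<le> c * norm x"
  shows "norm (adjoint T y) \<le> c * norm y"
proof (cases "adjoint T y = 0")
  case True
  have "0 \<le> c * norm y"
    using assms(2)[of y] norm_ge_zero order_trans by blast
  with True show ?thesis by simp
next
  case False
  have "(norm (adjoint T y))\<^sup>2 = T (adjoint T y) \<bullet> y"
    by (simp add: adjoint_inner[OF assms(1)] power2_norm_eq_inner)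
  also have "\<dots> \<le> norm (T (adjoint T y)) * norm y"
    by (rule norm_cauchy_schwarz)
  also have "\<dots> \<le> (c * norm (adjoint T y)) * norm y"
    by (intro mult_right_mono assms) auto
  finally have "norm (adjoint T y) * norm (adjoint T y) \<le> norm (adjoint T y) * (c * norm y)"
    by (simp add: power2_eq_square mult_ac)
  then show ?thesis
    using False by simp
qed

lemma card_orthonormal_le:
  fixes F :: "'h set"
  assumes F: "orthonormal F"
  shows "card F \<le> card E"
proof -
  have "real (card F) = (\<Sum>e\<in>F. e \<bullet> e)"
    using F by (simp add: orthonormal_def)
  also have "\<dots> = (\<Sum>e\<in>F. \<Sum>b\<in>E. (e \<bullet> b)\<^sup>2)"
    by (subst parseval) (simp add: power2_eq_square)
  also have "\<dots> = (\<Sum>b\<in>E. \<Sum>e\<in>F. (b \<bullet> e)\<^sup>2)"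
    by (subst sum.swap) (simp add: inner_commute)
  also have "\<dots> \<le> (\<Sum>b\<in>E. (norm b)\<^sup>2)"
    by (intro sum_mono orthonormal_bessel F)
  finally show ?thesis
    using norm_E by simp
qed

lemma subspace_basis:
  fixes V :: "'h set"
  assumes "subspace V"
  obtains F where "orthonormal F" "span F = V"
  using ex_orthonormal_basis[OF assms, of "card E" thesis] card_orthonormal_le that by simp

lemma orth_proj:
  fixes V :: "'h set"
  assumes "subspace V"
  shows orth_proj_mem: "orth_proj V x \<in> V"
    and orth_proj_orth: "v \<in> V \<Longrightarrow> (x - orth_proj V x) \<bullet> v = 0"
proof -
  obtain F where F: "orthonormal F" "span F = V"
    using subspace_basis[OF assms] .
  define p where "p = (\<Sum>b\<in>F. (x \<bullet> b) *\<^sub>R b)"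
  have p: "p \<in> V \<and> (\<forall>v\<in>V. (x - p) \<bullet> v = 0)"
    using orthonormal_residual[OF F(1)] F(2)
    by (auto simp: p_def span_scale span_sum span_base)
  have uniq: "q = p" if q: "q \<in> V \<and> (\<forall>v\<in>V. (x - q) \<bullet> v = 0)" for q
  proof -
    have "p - q \<in> V"
      using p q assms by (simp add: subspace_diff)
    then have "(x - p) \<bullet> (p - q) = 0" "(x - q) \<bullet> (p - q) = 0"
      using p q by auto
    then have "(p - q) \<bullet> (p - q) = 0"
      by (simp add: inner_diff_left)
    then show ?thesis by simp
  qed
  have eq: "orth_proj V x = p"
    unfolding orth_proj_def using p uniq by (rule the_equality)
  show "orth_proj V x \<in> V" "v \<in> V \<Longrightarrow> (x - orth_proj V x) \<bullet> v = 0"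
    unfolding eq using p by blast+
qed

lemma orth_proj_norm_le:
  fixes V :: "'h set"
  assumes "subspace V"
  shows "norm (orth_proj V x) \<le> norm x"
proof -
  have 0: "(x - orth_proj V x) \<bullet> orth_proj V x = 0"
    by (intro orth_proj_orth orth_proj_mem assms)
  have "(norm x)\<^sup>2 = (norm (orth_proj V x))\<^sup>2 + (norm (x - orth_proj V x))\<^sup>2"
    using 0 by (simp add: power2_norm_eq_inner inner_diff_left inner_diff_right inner_commute)
  then have "(norm (orth_proj V x))\<^sup>2 \<le> (norm x)\<^sup>2"
    by simp
  then show ?thesis
    by (rule power2_le_imp_le) simp
qed

lemma orth_proj_eqI:
  fixes V :: "'h set"
  assumes "subspace V" "p \<in> V" "\<And>v. v \<in> V \<Longrightarrow> (x - p) \<bullet> v = 0"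
  shows "orth_proj V x = p"
proof -
  have d: "orth_proj V x - p \<in> V"
    using orth_proj_mem[OF assms(1)] assms(1,2) by (simp add: subspace_diff)
  have "(x - p) \<bullet> (orth_proj V x - p) = 0" "(x - orth_proj V x) \<bullet> (orth_proj V x - p) = 0"
    using assms(3)[OF d] orth_proj_orth[OF assms(1) d] by auto
  then have "(orth_proj V x - p) \<bullet> (orth_proj V x - p) = 0"
    by (simp add: inner_diff_left)
  then show ?thesis by simp
qed

lemma linear_orth_proj:
  fixes V :: "'h set"
  assumes "subspace V"
  shows "linear (orth_proj V)"
proof (rule linearI)
  fix x y :: 'h and c :: real
  note m = orth_proj_mem[OF assms] and o = orth_proj_orth[OF assms]
  show "orth_proj V (x + y) = orth_proj V x + orth_proj V y"
  proof (rule orth_proj_eqI[OF assms])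
    show "orth_proj V x + orth_proj V y \<in> V"
      using m assms by (simp add: subspace_add)
    show "(x + y - (orth_proj V x + orth_proj V y)) \<bullet> v = 0" if "v \<in> V" for v
      using o[OF that, of x] o[OF that, of y] by (simp add: inner_diff_left inner_add_left)
  qed
  show "orth_proj V (c *\<^sub>R x) = c *\<^sub>R orth_proj V x"
  proof (rule orth_proj_eqI[OF assms])
    show "c *\<^sub>R orth_proj V x \<in> V"
      using m assms by (simp add: subspace_scale)
    show "(c *\<^sub>R x - c *\<^sub>R orth_proj V x) \<bullet> v = 0" if "v \<in> V" for v
      using o[OF that, of x] by (simp add: inner_diff_left)
  qed
qed

text \<open>A self-adjoint operator that is injective on an invariant subspace is onto it: a vector of
  the subspace orthogonal to the image is annihilated.\<close>

lemma self_adjoint_surj: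
  fixes V :: "'h set"
  assumes V: "subspace V" and T: "linear T"
    and sa: "\<And>x y. T x \<bullet> y = x \<bullet> T y"
    and inv: "T ` V \<subseteq> V" and inj: "\<And>x. x \<in> V \<Longrightarrow> T x = 0 \<Longrightarrow> x = 0"
  shows "T ` V = V"
proof
  show "V \<subseteq> T ` V"
  proof
    fix x assume x: "x \<in> V"
    have W: "subspace (T ` V)"
      using T V by (rule linear_subspace_image)
    define r where "r = x - orth_proj (T ` V) x"
    have rV: "r \<in> V"
      unfolding r_def by (rule subspace_diff[OF V x subsetD[OF inv orth_proj_mem[OF W]]])
    have "T (T r) \<in> T ` V"
      using imageI[OF subsetD[OF inv imageI[OF rV]]] .
    then have "r \<bullet> T (T r) = 0"
      unfolding r_def by (rule orth_proj_orth[OF W])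
    then have "T r \<bullet> T r = 0"
      by (simp only: sa)
    then have "r = 0"
      by (intro inj[OF rV]) (simp only: inner_eq_zero_iff)
    then have "orth_proj (T ` V) x = x"
      by (simp only: r_def right_minus_eq)
    then show "x \<in> T ` V"
      using orth_proj_mem[OF W, of x] by (simp only:)
  qed
next
  show "T ` V \<subseteq> V" by (rule inv)
qed

text \<open>The constant is the sum of the norms of preimages of an orthonormal basis of the subspace, since
  \<open>\<langle>x, e\<rangle> = \<langle>T x, g\<rangle>\<close> whenever \<open>T g = e\<close>.\<close>

lemma self_adjoint_lower_bound_ex:
  fixes V :: "'h set"
  assumes V: "subspace V" and T: "linear T"
    and sa: "\<And>x y. T x \<bullet> y = x \<bullet> T y"
    and inv: "T ` V \<subseteq> V" and inj: "\<And>x. x \<in> V \<Longrightarrow> T x = 0 \<Longrightarrow> x = 0"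
  obtains M where "M \<ge> 0" "\<And>x. x \<in> V \<Longrightarrow> norm x \<le> M * norm (T x)"
proof -
  have onto: "T ` V = V"
    by (rule self_adjoint_surj[OF V T sa inv inj])
  obtain F where F: "orthonormal F" "span F = V"
    using subspace_basis[OF V] .
  have "\<exists>g. T g = e" if "e \<in> F" for e
  proof -
    have "e \<in> V"
      using F(2) that span_base by blast
    then show ?thesis
      using onto by (metis imageE)
  qed
  then obtain g where g: "\<And>e. e \<in> F \<Longrightarrow> T (g e) = e"
    by metis
  show ?thesis
  proof (rule that)
    show "0 \<le> (\<Sum>e\<in>F. norm (g e))"
      by (simp add: sum_nonneg)
    fix x assume x: "x \<in> V"
    have "x = (\<Sum>e\<in>F. (x \<bullet> e) *\<^sub>R e)"
      using orthonormal_expand[OF F(1)] x F(2) by simp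
    then have "norm x \<le> (\<Sum>e\<in>F. norm ((x \<bullet> e) *\<^sub>R e))"
      using norm_sum[of "\<lambda>e. (x \<bullet> e) *\<^sub>R e" F] by simp
    also have "\<dots> \<le> (\<Sum>e\<in>F. norm (g e) * norm (T x))"
    proof (rule sum_mono)
      fix e assume e: "e \<in> F"
      have "x \<bullet> e = T x \<bullet> g e"
        using g[OF e] by (simp add: sa)
      then have "\<bar>x \<bullet> e\<bar> \<le> norm (T x) * norm (g e)"
        by (simp add: Cauchy_Schwarz_ineq2)
      moreover have "norm e = 1"
        using F(1) e by (simp add: orthonormal_def norm_eq_1)
      ultimately show "norm ((x \<bullet> e) *\<^sub>R e) \<le> norm (g e) * norm (T x)"
        by (simp add: mult.commute)
    qed
    finally show "norm x \<le> (\<Sum>e\<in>F. norm (g e)) * norm (T x)"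
      by (simp add: sum_distrib_right)
  qed
qed

end

section \<open>Reproducing kernel Hilbert spaces of bounded kernels\<close>

locale kernel_space =
  fixes X :: "'a::euclidean_space set" and k :: "'a \<Rightarrow> 'a \<Rightarrow> real"
    and evl :: "'h::{real_inner, banach, second_countable_topology} \<Rightarrow> 'a \<Rightarrow> real"
    and K :: real
  assumes rk: "rkhs X k evl" and K_pos: "0 < K" and k_le: "\<And>x. x \<in> X \<Longrightarrow> k x x \<le> K"
begin

abbreviation \<Phi> :: "'a \<Rightarrow> 'h" where "\<Phi> \<equiv> feature X k evl"

lemma inj_evl: "inj evl"
  and evl_outside: "x \<notin> X \<Longrightarrow> evl \<psi> x = 0"
  using rk unfolding rkhs_def by blast+

lemma feature_outside [simp]: "x \<notin> X \<Longrightarrow> \<Phi> x = 0"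
  by (simp add: feature_def)

lemma feature_spec:
  assumes "x \<in> X"
  shows evl_feature: "evl (\<Phi> x) = zero_ext X (\<lambda>y. k y x)"
    and reproducing: "evl \<psi> x = \<psi> \<bullet> \<Phi> x"
proof -
  from rk assms obtain \<phi> where \<phi>: "evl \<phi> = zero_ext X (\<lambda>y. k y x)" "\<forall>\<psi>. evl \<psi> x = \<psi> \<bullet> \<phi>"
    by (auto simp: rkhs_def)
  have "\<Phi> x = \<phi>"
    using assms inj_evl by (simp add: feature_def \<phi>(1)[symmetric])
  then show "evl (\<Phi> x) = zero_ext X (\<lambda>y. k y x)" "evl \<psi> x = \<psi> \<bullet> \<Phi> x"
    using \<phi> by auto
qed

lemma evl_inner: "evl \<psi> x = \<psi> \<bullet> \<Phi> x"
  by (cases "x \<in> X") (auto simp: evl_outside reproducing)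

lemma evl_eqI:
  assumes "\<And>x. x \<in> X \<Longrightarrow> evl \<psi> x = evl \<phi> x"
  shows "\<psi> = \<phi>"
proof (rule injD[OF inj_evl], rule ext)
  show "evl \<psi> x = evl \<phi> x" for x
    using assms evl_outside by (cases "x \<in> X") auto
qed

lemma norm_feature_sq: "(norm (\<Phi> x))\<^sup>2 \<le> K"
proof (cases "x \<in> X")
  case True
  have "(norm (\<Phi> x))\<^sup>2 = evl (\<Phi> x) x"
    using reproducing[OF True, of "\<Phi> x"] by (simp add: power2_norm_eq_inner)
  also have "\<dots> = k x x"
    using evl_feature[OF True] True by (simp add: zero_ext_def)
  finally show ?thesis
    using k_le[OF True] by simp
qed (use K_pos in auto)

lemma norm_feature: "norm (\<Phi> x) \<le> sqrt K"
  by (rule real_le_rsqrt[OF norm_feature_sq])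

lemma abs_evl_le: "\<bar>evl \<psi> x\<bar> \<le> sqrt K * norm \<psi>"
proof -
  have "\<bar>evl \<psi> x\<bar> \<le> norm \<psi> * norm (\<Phi> x)"
    using Cauchy_Schwarz_ineq2[of \<psi> "\<Phi> x"] by (simp only: evl_inner)
  also have "\<dots> \<le> norm \<psi> * sqrt K"
    by (intro mult_left_mono norm_feature) auto
  finally show ?thesis
    by (simp add: mult.commute)
qed

lemma sqrt_K_sq: "sqrt K * sqrt K = K"
  using K_pos by simp

lemma norm_evl_feature_le: "norm (evl \<psi> x *\<^sub>R \<Phi> y) \<le> K * norm \<psi>"
proof -
  have "norm (evl \<psi> x *\<^sub>R \<Phi> y) \<le> (sqrt K * norm \<psi>) * sqrt K"
    unfolding norm_scaleR using K_pos
    by (intro mult_mono abs_evl_le norm_feature) auto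
  also have "\<dots> = (sqrt K * sqrt K) * norm \<psi>"
    by simp
  finally show ?thesis
    by (simp only: sqrt_K_sq)
qed

end

section \<open>Coercive covariance operators force finite dimension\<close>

locale coercive_kernel = kernel_space X k evl K
  for X :: "'a::euclidean_space set" and k
    and evl :: "'h::{real_inner, banach, second_countable_topology} \<Rightarrow> 'a \<Rightarrow> real" and K +
  fixes \<mu> :: "'a measure" and c1 :: real
  assumes prob_\<mu>: "prob_space \<mu>" and sets_\<mu> [measurable_cong]: "sets \<mu> = sets borel"
    and c1_pos: "0 < c1" and coercive: "\<And>\<psi>. c1 * norm \<psi> \<le> norm (cov X k evl \<mu> \<psi>)"
begin

abbreviation C :: "'h \<Rightarrow> 'h" where "C \<equiv> cov X k evl \<mu>"

text \<open>Coercivity already yields integrability: the Bochner integral of a non-integrable function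
  is zero by convention.\<close>

lemma cov_integrable: "integrable \<mu> (\<lambda>x. evl \<psi> x *\<^sub>R \<Phi> x)"
proof (rule ccontr)
  assume ni: "\<not> integrable \<mu> (\<lambda>x. evl \<psi> x *\<^sub>R \<Phi> x)"
  then have "C \<psi> = 0"
    by (simp add: cov_def tensor_feature_def not_integrable_integral_eq)
  then have "c1 * norm \<psi> \<le> 0"
    using coercive[of \<psi>] by simp
  then have "\<psi> = 0"
    using c1_pos by (simp add: mult_le_0_iff)
  then have "(\<lambda>x. evl \<psi> x *\<^sub>R \<Phi> x) = (\<lambda>x. 0)"
    by (simp add: evl_inner)
  then show False
    using ni by simp
qed

lemma cov_eq: "C \<psi> = (LINT x|\<mu>. evl \<psi> x *\<^sub>R \<Phi> x)"
  by (simp add: cov_def tensor_feature_def)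

lemma evl_mult_integrable: "integrable \<mu> (\<lambda>x. evl \<psi> x * evl \<phi> x)"
proof -
  have "integrable \<mu> (\<lambda>x. (evl \<psi> x *\<^sub>R \<Phi> x) \<bullet> \<phi>)"
    by (intro integrable_inner_left) (rule cov_integrable)
  moreover have "(\<lambda>x. (evl \<psi> x *\<^sub>R \<Phi> x) \<bullet> \<phi>) = (\<lambda>x. evl \<psi> x * evl \<phi> x)"
    by (auto simp: evl_inner inner_commute)
  ultimately show ?thesis by simp
qed

lemma cov_inner: "C \<psi> \<bullet> \<phi> = (LINT x|\<mu>. evl \<psi> x * evl \<phi> x)"
proof -
  have "C \<psi> \<bullet> \<phi> = (LINT x|\<mu>. (evl \<psi> x *\<^sub>R \<Phi> x) \<bullet> \<phi>)"
    unfolding cov_eq by (intro integral_inner_left[symmetric]) (rule cov_integrable)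
  also have "(\<lambda>x. (evl \<psi> x *\<^sub>R \<Phi> x) \<bullet> \<phi>) = (\<lambda>x. evl \<psi> x * evl \<phi> x)"
    by (auto simp: evl_inner inner_commute)
  finally show ?thesis .
qed

lemma cov_self_adjoint: "C \<psi> \<bullet> \<phi> = \<psi> \<bullet> C \<phi>"
  unfolding inner_commute[of \<psi>] cov_inner by (simp only: mult.commute)

lemma linear_cov: "linear C"
proof (rule linearI)
  show "C (\<psi> + \<phi>) = C \<psi> + C \<phi>" for \<psi> \<phi>
    using Bochner_Integration.integral_add[OF cov_integrable cov_integrable, of \<psi> \<phi>]
    unfolding cov_eq by (simp add: evl_inner inner_add_left scaleR_add_left)
  show "C (c *\<^sub>R \<psi>) = c *\<^sub>R C \<psi>" for c \<psi>
    using Bochner_Integration.integral_scaleR_right[where M = \<mu> and c = c and f = "\<lambda>x. evl \<psi> x *\<^sub>R \<Phi> x"]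
    unfolding cov_eq by (simp add: evl_inner)
qed

lemma cov_inj: "C \<psi> = 0 \<Longrightarrow> \<psi> = 0"
  using coercive[of \<psi>] c1_pos by (simp add: mult_le_0_iff)

lemma cov_quadratic_nonneg: "0 \<le> C \<psi> \<bullet> \<psi>"
  unfolding cov_inner by (intro Bochner_Integration.integral_nonneg) simp

lemma cov_quadratic_le: "C \<psi> \<bullet> \<psi> \<le> K * (norm \<psi>)\<^sup>2"
proof -
  interpret prob_space \<mu> by (rule prob_\<mu>)
  have "C \<psi> \<bullet> \<psi> \<le> (LINT x|\<mu>. K * (norm \<psi>)\<^sup>2)"
    unfolding cov_inner
  proof (rule integral_mono)
    show "integrable \<mu> (\<lambda>x. evl \<psi> x * evl \<psi> x)"
      by (rule evl_mult_integrable)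
    show "evl \<psi> x * evl \<psi> x \<le> K * (norm \<psi>)\<^sup>2" for x
    proof -
      have "\<bar>evl \<psi> x\<bar> * \<bar>evl \<psi> x\<bar> \<le> (sqrt K * norm \<psi>) * (sqrt K * norm \<psi>)"
        using K_pos by (intro mult_mono abs_evl_le) auto
      also have "\<dots> = (sqrt K * sqrt K) * (norm \<psi> * norm \<psi>)"
        by simp
      finally show ?thesis
        unfolding sqrt_K_sq power2_eq_square abs_mult_self_eq .
    qed
  qed simp
  then show ?thesis
    by (simp add: prob_space)
qed

text \<open>The coercivity bound on \<open>\<parallel>C \<psi>\<parallel>\<close> upgrades to one on the quadratic form because \<open>C\<close> is positive
  with \<open>C \<le> K\<close>: evaluating the form at \<open>\<psi> - K\<^sup>-\<^sup>1 C \<psi>\<close> gives \<open>\<parallel>C \<psi>\<parallel>\<^sup>2 \<le> K \<langle>C \<psi>, \<psi>\<rangle>\<close>.\<close>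

lemma cov_norm_sq_le: "(norm (C \<psi>))\<^sup>2 \<le> K * (C \<psi> \<bullet> \<psi>)"
proof -
  define g where "g = C \<psi>"
  \<comment> \<open>The minimiser of the quadratic in \<open>t\<close> that arises from \<open>C \<le> K\<close>.\<close>
  define t where "t = 1 / K"
  have "C (\<psi> - t *\<^sub>R g) = g - t *\<^sub>R C g"
    by (simp add: linear_diff[OF linear_cov] linear_scale[OF linear_cov] g_def)
  then have "0 \<le> (g - t *\<^sub>R C g) \<bullet> (\<psi> - t *\<^sub>R g)"
    using cov_quadratic_nonneg[of "\<psi> - t *\<^sub>R g"] by simp
  also have "\<dots> = g \<bullet> \<psi> - t * (g \<bullet> g) - t * (C g \<bullet> \<psi>) + t * t * (C g \<bullet> g)"
    by (simp add: inner_diff_left inner_diff_right algebra_simps)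
  also have "C g \<bullet> \<psi> = g \<bullet> g"
    by (simp add: cov_self_adjoint g_def)
  also have "t * t * (C g \<bullet> g) \<le> t * t * (K * (norm g)\<^sup>2)"
    by (intro mult_left_mono cov_quadratic_le) simp
  also have "t * t * (K * (norm g)\<^sup>2) = t * (g \<bullet> g)"
    using K_pos by (simp add: t_def power2_norm_eq_inner)
  finally have "t * (g \<bullet> g) \<le> g \<bullet> \<psi>"
    by simp
  then show ?thesis
    using K_pos by (simp add: t_def g_def power2_norm_eq_inner field_simps)
qed

text \<open>\<open>C\<close> is trace class with trace at most \<open>K\<close>, so orthonormal systems, each member of which
  contributes at least \<open>c1\<^sup>2 / K\<close> to the trace, have bounded size.\<close>

lemma card_orthonormal_bound:
  fixes F :: "'h set"
  assumes F: "orthonormal F"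
  shows "real (card F) \<le> K\<^sup>2 / c1\<^sup>2"
proof -
  interpret prob_space \<mu> by (rule prob_\<mu>)
  have fin: "finite F"
    using F by (simp add: orthonormal_def)
  have "real (card F) * c1\<^sup>2 = (\<Sum>e\<in>F. c1\<^sup>2)"
    by simp
  also have "\<dots> \<le> (\<Sum>e\<in>F. K * (C e \<bullet> e))"
  proof (rule sum_mono)
    fix e assume "e \<in> F"
    then have "norm e = 1"
      using F by (simp add: orthonormal_def norm_eq_1)
    then have "c1\<^sup>2 \<le> (norm (C e))\<^sup>2"
      using coercive[of e] c1_pos by (intro power_mono) auto
    then show "c1\<^sup>2 \<le> K * (C e \<bullet> e)"
      using cov_norm_sq_le[of e] by simp
  qed
  also have "\<dots> = K * (LINT x|\<mu>. (\<Sum>e\<in>F. evl e x * evl e x))"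
    by (subst Bochner_Integration.integral_sum)
      (auto simp: cov_inner sum_distrib_left intro: evl_mult_integrable)
  also have "\<dots> \<le> K * (LINT x|\<mu>. K)"
  proof (intro mult_left_mono integral_mono)
    show "integrable \<mu> (\<lambda>x. \<Sum>e\<in>F. evl e x * evl e x)"
      by (intro Bochner_Integration.integrable_sum evl_mult_integrable)
    show "(\<Sum>e\<in>F. evl e x * evl e x) \<le> K" for x
    proof -
      have "(\<Sum>e\<in>F. evl e x * evl e x) = (\<Sum>e\<in>F. (\<Phi> x \<bullet> e)\<^sup>2)"
        by (intro sum.cong) (auto simp: evl_inner inner_commute power2_eq_square)
      also have "\<dots> \<le> (norm (\<Phi> x))\<^sup>2"
        by (rule orthonormal_bessel[OF F])
      finally show ?thesis
        using norm_feature_sq[of x] by simp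
    qed
  qed (use K_pos in auto)
  finally show ?thesis
    using c1_pos by (simp add: prob_space field_simps power2_eq_square)
qed

lemma ex_finite_onb: "\<exists>E :: 'h set. finite_onb E"
proof -
  have "card F \<le> nat \<lfloor>K\<^sup>2 / c1\<^sup>2\<rfloor>" if "orthonormal F" for F :: "'h set"
    using card_orthonormal_bound[OF that] by (simp add: le_nat_iff le_floor_iff)
  then obtain E :: "'h set" where "orthonormal E" "span E = UNIV"
    using ex_orthonormal_basis[OF subspace_UNIV, of "nat \<lfloor>K\<^sup>2 / c1\<^sup>2\<rfloor>"] by metis
  then show ?thesis
    by (auto simp: finite_onb_def)
qed

end

section \<open>Measurability of the feature map\<close>

locale fd_kernel_space = kernel_space X k evl K + finite_onb E
  for X :: "'a::euclidean_space set" and k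
    and evl :: "'h::{real_inner, banach, second_countable_topology} \<Rightarrow> 'a \<Rightarrow> real" and K
    and E :: "'h set" +
  assumes X_borel [measurable]: "X \<in> sets borel"
    and k_measurable: "(\<lambda>p. k (fst p) (snd p)) \<in> borel_measurable (restrict_space borel (X \<times> X))"
begin

text \<open>A function orthogonal to all features vanishes at all points.\<close>

lemma span_features: "span (range \<Phi>) = UNIV"
proof -
  let ?V = "span (range \<Phi>)"
  have "\<psi> \<in> ?V" for \<psi>
  proof -
    have "evl (\<psi> - orth_proj ?V \<psi>) x = evl 0 x" for x
      using orth_proj_orth[OF subspace_span, of "\<Phi> x" "range \<Phi>" \<psi>]
      by (simp add: evl_inner span_base)
    then have "\<psi> - orth_proj ?V \<psi> = 0"
      by (intro evl_eqI)
    then have "orth_proj ?V \<psi> = \<psi>"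
      by simp
    with orth_proj_mem[OF subspace_span, of "range \<Phi>" \<psi>] show ?thesis
      by metis
  qed
  then show ?thesis by blast
qed

text \<open>Members of the space inherit measurability from the kernel sections, of which they are finite
  linear combinations in finite dimension.\<close>

lemma evl_measurable [measurable]: "evl \<psi> \<in> borel_measurable borel"
proof -
  have "\<psi> \<in> span (range \<Phi>)"
    by (simp add: span_features)
  then show ?thesis
  proof (induction rule: span_induct)
    case base
    show ?case
    proof (rule subspaceI)
      have "evl 0 = (\<lambda>x. 0)"
        by (auto simp: evl_inner)
      then show "0 \<in> {x. evl x \<in> borel_measurable borel}"
        by simp
    next
      fix u v assume "u \<in> {x. evl x \<in> borel_measurable borel}" "v \<in> {x. evl x \<in> borel_measurable borel}"
      moreover have "evl (u + v) = (\<lambda>x. evl u x + evl v x)"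
        by (auto simp: evl_inner inner_add_left)
      ultimately show "u + v \<in> {x. evl x \<in> borel_measurable borel}"
        by simp
    next
      fix c u assume "u \<in> {x. evl x \<in> borel_measurable borel}"
      moreover have "evl (c *\<^sub>R u) = (\<lambda>x. c * evl u x)"
        by (auto simp: evl_inner)
      ultimately show "c *\<^sub>R u \<in> {x. evl x \<in> borel_measurable borel}"
        by simp
    qed
  next
    case (step \<phi>)
    then obtain y where y: "\<phi> = \<Phi> y" by auto
    show ?case
    proof (cases "y \<in> X")
      case True
      have "(\<lambda>x. (x, y)) \<in> measurable (restrict_space borel X) (restrict_space borel (X \<times> X))"
        using True by (intro measurable_restrict_space3) (auto simp: space_restrict_space)
      from measurable_compose[OF this k_measurable]
      have "(\<lambda>x. k x y) \<in> borel_measurable (restrict_space borel X)"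
        by simp
      then have "(\<lambda>x. if x \<in> X then k x y else 0) \<in> borel_measurable borel"
        by (subst (asm) measurable_restrict_space_iff[where c = 0]) auto
      then show ?thesis
        unfolding y evl_feature[OF True] zero_ext_def .
    next
      case False
      then have "evl \<phi> = (\<lambda>x. 0)"
        by (auto simp: evl_inner y)
      then show ?thesis
        by simp
    qed
  qed
qed

lemma feature_measurable [measurable]: "\<Phi> \<in> borel_measurable borel"
proof -
  have "\<Phi> = (\<lambda>x. \<Sum>b\<in>E. evl b x *\<^sub>R b)"
    by (auto simp: evl_inner inner_commute[of _ "\<Phi> _"] expand)
  moreover have "(\<lambda>x. \<Sum>b\<in>E. evl b x *\<^sub>R b) \<in> borel_measurable borel"
    by measurable
  ultimately show ?thesis by simp
qed

end

section \<open>The Koopman operator and the lifting-back operator\<close>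

text \<open>The constant \<open>R\<close> records that the state space is bounded.\<close>

locale koopman_setting =
  fd_kernel_space X k evl K E + coercive_kernel X k evl K \<mu> c1
  for X :: "'a::euclidean_space set" and k
    and evl :: "'h::{real_inner, banach, second_countable_topology} \<Rightarrow> 'a \<Rightarrow> real" and K
    and E :: "'h set" and \<mu> c1 +
  fixes \<nu> :: "'w measure" and f :: "'a \<Rightarrow> 'w \<Rightarrow> 'a" and R :: real
  assumes prob_\<nu>: "prob_space \<nu>"
    and dynamics [measurable]: "(\<lambda>(x, u). f x u) \<in> borel_measurable (borel \<Otimes>\<^sub>M \<nu>)"
    and invariant: "\<And>x. x \<in> X \<Longrightarrow> measure (transition \<nu> f x) X = 1"
    and \<mu>_X: "measure \<mu> X = 1"
    and koopman_invariant: "\<And>\<psi>. koopman_fun X \<nu> f (evl \<psi>) \<in> range evl"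
    and lift_back_adj: "\<And>v. lift_back_adj_fun X v \<in> range evl"
    and R_nonneg: "0 \<le> R" and norm_le_R: "\<And>x. x \<in> X \<Longrightarrow> norm x \<le> R"
begin

sublocale \<nu>: prob_space \<nu> by (rule prob_\<nu>)
sublocale \<mu>: prob_space \<mu> by (rule prob_\<mu>)

abbreviation U :: "'h \<Rightarrow> 'h" where "U \<equiv> koopman X evl \<nu> f"
abbreviation U' :: "'h \<Rightarrow> 'h" where "U' \<equiv> koopman_adj X evl \<nu> f"
abbreviation B :: "'h \<Rightarrow> 'a" where "B \<equiv> lift_back X k evl \<mu>"

lemma dynamics_measurable [measurable (raw)]:
  assumes "g \<in> borel_measurable M" "h \<in> measurable M \<nu>"
  shows "(\<lambda>\<omega>. f (g \<omega>) (h \<omega>)) \<in> borel_measurable M"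
  using measurable_compose[OF measurable_Pair[OF assms] dynamics] by simp

lemma AE_step_in_X:
  assumes "x \<in> X"
  shows "AE u in \<nu>. f x u \<in> X"
proof -
  have m: "f x \<in> borel_measurable \<nu>"
    by measurable
  have "measure \<nu> (f x -` X \<inter> space \<nu>) = 1"
    using invariant[OF assms] unfolding transition_def by (subst (asm) measure_distr[OF m X_borel])
  then have "AE u in \<nu>. u \<in> f x -` X \<inter> space \<nu>"
    by (rule \<nu>.AE_prob_1)
  then show ?thesis
    by eventually_elim simp
qed

lemma AE_\<mu>_in_X: "AE x in \<mu>. x \<in> X"
  by (rule \<mu>.AE_prob_1[OF \<mu>_X])

lemma evl_koopman: "evl (U \<psi>) = koopman_fun X \<nu> f (evl \<psi>)"
  unfolding koopman_def by (rule f_inv_into_f[OF koopman_invariant])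

lemma evl_step_integrable: "integrable \<nu> (\<lambda>u. evl \<psi> (f x u))"
  by (rule \<nu>.integrable_const_bound[where B = "sqrt K * norm \<psi>"])
    (auto intro: abs_evl_le)

lemma evl_koopman_eq:
  assumes "x \<in> X"
  shows "evl (U \<psi>) x = (LINT u|\<nu>. evl \<psi> (f x u))"
proof -
  have ind: "indicator X y *\<^sub>R evl \<psi> y = evl \<psi> y" for y
    by (auto simp: indicator_def evl_outside)
  have "evl (U \<psi>) x = (LINT y|distr \<nu> borel (f x). evl \<psi> y)"
    using assms by (simp add: evl_koopman koopman_fun_def zero_ext_def set_lebesgue_integral_def
        transition_def ind del: real_scaleR_def)
  also have "\<dots> = (LINT u|\<nu>. evl \<psi> (f x u))"
    by (rule integral_distr) measurable
  finally show ?thesis .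
qed

lemma linear_koopman: "linear U"
proof (rule linearI)
  show "U (\<psi> + \<phi>) = U \<psi> + U \<phi>" for \<psi> \<phi>
  proof (rule evl_eqI)
    fix x assume x: "x \<in> X"
    have "evl (U (\<psi> + \<phi>)) x = (LINT u|\<nu>. evl \<psi> (f x u) + evl \<phi> (f x u))"
      unfolding evl_koopman_eq[OF x] by (simp add: evl_inner inner_add_left)
    also have "\<dots> = evl (U \<psi>) x + evl (U \<phi>) x"
      unfolding evl_koopman_eq[OF x]
      by (intro Bochner_Integration.integral_add evl_step_integrable)
    finally show "evl (U (\<psi> + \<phi>)) x = evl (U \<psi> + U \<phi>) x"
      by (simp add: evl_inner inner_add_left)
  qed
  show "U (c *\<^sub>R \<psi>) = c *\<^sub>R U \<psi>" for c \<psi>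
  proof (rule evl_eqI)
    fix x assume x: "x \<in> X"
    have "evl (U (c *\<^sub>R \<psi>)) x = (LINT u|\<nu>. c * evl \<psi> (f x u))"
      unfolding evl_koopman_eq[OF x] by (simp add: evl_inner)
    also have "\<dots> = c * evl (U \<psi>) x"
      unfolding evl_koopman_eq[OF x] by simp
    finally show "evl (U (c *\<^sub>R \<psi>)) x = evl (c *\<^sub>R U \<psi>) x"
      by (simp add: evl_inner)
  qed
qed

lemma koopman_adj_inner: "U \<psi> \<bullet> \<phi> = \<psi> \<bullet> U' \<phi>"
  unfolding koopman_adj_def by (rule adjoint_inner[OF linear_koopman])

text \<open>The element of the Hilbert space representing \<open>x \<mapsto> \<langle>v, x\<rangle>\<close>, i.e. \<open>B\<^sup>* v\<close>.\<close>

definition coord :: "'a \<Rightarrow> 'h" where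
  "coord v = inv evl (lift_back_adj_fun X v)"

lemma evl_coord: "x \<in> X \<Longrightarrow> evl (coord v) x = v \<bullet> x"
  unfolding coord_def f_inv_into_f[OF lift_back_adj] by (simp add: lift_back_adj_fun_def zero_ext_def)

lemma evl_mult_coord: "evl \<psi> x * (v \<bullet> x) = evl \<psi> x * evl (coord v) x"
  by (cases "x \<in> X") (auto simp: evl_outside evl_coord)

lemma norm_evl_id_le: "norm (evl \<psi> x *\<^sub>R x) \<le> sqrt K * norm \<psi> * R"
proof (cases "x \<in> X")
  case True
  then show ?thesis
    using K_pos by (auto intro!: mult_mono abs_evl_le norm_le_R)
next
  case False
  then show ?thesis
    using K_pos R_nonneg by (simp add: evl_outside)
qed

lemma cov_surj: "C (inv C \<psi>) = \<psi>"
proof -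
  have "C ` UNIV = UNIV"
  proof (rule self_adjoint_surj)
    show "C \<psi> \<bullet> \<phi> = \<psi> \<bullet> C \<phi>" for \<psi> \<phi>
      by (rule cov_self_adjoint)
    show "\<psi> = 0" if "C \<psi> = 0" for \<psi>
      using cov_inj[OF that] .
  qed (simp_all add: linear_cov)
  then show ?thesis
    by (intro f_inv_into_f) auto
qed

text \<open>This is \<open>B\<^sup>* v = \<langle>v, \<cdot>\<rangle>\<close>: integrating \<open>\<langle>v, x\<rangle>\<close> against \<open>C\<^sup>-\<^sup>1 \<psi>\<close> is the same as pairing
  \<open>C (C\<^sup>-\<^sup>1 \<psi>)\<close> with the function \<open>\<langle>v, \<cdot>\<rangle>\<close>.\<close>

lemma lift_back_inner: "v \<bullet> B \<psi> = \<psi> \<bullet> coord v"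
proof -
  define g where "g = inv C \<psi>"
  have "integrable \<mu> (\<lambda>x. evl g x *\<^sub>R x)"
    by (rule \<mu>.integrable_const_bound[where B = "sqrt K * norm g * R"])
      (auto intro: norm_evl_id_le simp del: norm_scaleR)
  then have "v \<bullet> B \<psi> = (LINT x|\<mu>. v \<bullet> (evl g x *\<^sub>R x))"
    unfolding lift_back_def comp_def cov_id_def tensor_feature_def g_def[symmetric]
    by (rule integral_inner_right[symmetric])
  also have "\<dots> = C g \<bullet> coord v"
    by (simp add: cov_inner evl_mult_coord)
  finally show ?thesis
    by (simp add: g_def cov_surj)
qed

lemma linear_lift_back: "linear B"
proof (rule linearI)
  show "B (\<psi> + \<phi>) = B \<psi> + B \<phi>" for \<psi> \<phi>
    by (rule vector_eq_ldot[THEN iffD1]) (simp add: inner_add_right lift_back_inner inner_add_left)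
  show "B (c *\<^sub>R \<psi>) = c *\<^sub>R B \<psi>" for c \<psi>
    by (rule vector_eq_ldot[THEN iffD1]) (simp add: lift_back_inner)
qed

section \<open>Empirical operators for a fixed sample\<close>

context
  fixes N :: nat and z :: "nat \<Rightarrow> 'a \<times> 'a"
  assumes N_pos: "0 < N"
begin

abbreviation "H\<^sub>N \<equiv> emp_space X k evl N z"
abbreviation "C\<^sub>N \<equiv> emp_cov X k evl N z"
abbreviation "D\<^sub>N \<equiv> emp_cross_cov X k evl N z"
abbreviation "U\<^sub>N \<equiv> emp_koopman X k evl N z"
abbreviation "B\<^sub>N \<equiv> emp_lift_back X k evl N z"
abbreviation "I\<^sub>N \<equiv> emp_cov_inv X k evl N z"

lemma linear_average:
  assumes "\<And>i. linear (T i)"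
  shows "linear (\<lambda>\<psi>. (1 / real N) *\<^sub>R (\<Sum>i<N. T i \<psi>))"
  using assms by (intro linear_compose_scale_right linear_compose_sum) auto

lemma linear_tensor_feature: "linear (tensor_feature evl u y)"
  unfolding tensor_feature_def
  by (rule linearI) (auto simp: evl_inner inner_add_left scaleR_add_left)

lemma linear_emp_cov: "linear C\<^sub>N"
  and linear_emp_cross_cov: "linear D\<^sub>N"
  and linear_emp_cov_id: "linear (emp_cov_id evl N z)"
  unfolding emp_cov_def[abs_def] emp_cross_cov_def[abs_def] emp_cov_id_def[abs_def]
  by (intro linear_average linear_tensor_feature)+

lemma emp_cov_inner: "C\<^sub>N \<psi> \<bullet> \<phi> = (1 / real N) * (\<Sum>i<N. evl \<psi> (fst (z i)) * evl \<phi> (fst (z i)))"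
  by (simp add: emp_cov_def tensor_feature_def inner_sum_left evl_inner
      inner_commute[of "\<Phi> _"])

lemma emp_cross_cov_inner:
  "D\<^sub>N \<psi> \<bullet> \<phi> = (1 / real N) * (\<Sum>i<N. evl \<psi> (snd (z i)) * evl \<phi> (fst (z i)))"
  by (simp add: emp_cross_cov_def tensor_feature_def inner_sum_left evl_inner
      inner_commute[of "\<Phi> _"])

lemma emp_cov_self_adjoint: "C\<^sub>N \<psi> \<bullet> \<phi> = \<psi> \<bullet> C\<^sub>N \<phi>"
  unfolding inner_commute[of \<psi>] emp_cov_inner by (simp only: mult.commute)

lemma subspace_emp_space: "subspace H\<^sub>N"
  by (simp add: emp_space_def)

lemma feature_in_emp_space: "i < N \<Longrightarrow> \<Phi> (fst (z i)) \<in> H\<^sub>N"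
  unfolding emp_space_def by (intro span_base) auto

lemma emp_cov_in_emp_space: "C\<^sub>N \<psi> \<in> H\<^sub>N"
  unfolding emp_cov_def tensor_feature_def
  by (intro subspace_scale subspace_sum subspace_emp_space feature_in_emp_space) auto

text \<open>The kernel of \<open>C\<^sup>N\<close> consists of the functions vanishing at all sample points, that is, of
  the orthogonal complement of \<open>H\<^sub>N\<close>.\<close>

lemma emp_cov_inj_on_emp_space:
  assumes "\<psi> \<in> H\<^sub>N" "C\<^sub>N \<psi> = 0"
  shows "\<psi> = 0"
proof -
  have "(1 / real N) * (\<Sum>i<N. evl \<psi> (fst (z i)) * evl \<psi> (fst (z i))) = 0"
    using emp_cov_inner[of \<psi> \<psi>] assms(2) by simp
  then have "\<forall>i<N. \<psi> \<bullet> \<Phi> (fst (z i)) = 0"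
    using N_pos by (simp add: sum_nonneg_eq_0_iff evl_inner)
  then have "orthogonal \<psi> y" if "y \<in> (\<lambda>i. \<Phi> (fst (z i))) ` {..<N}" for y
    using that by (auto simp: orthogonal_def)
  then have "orthogonal \<psi> \<psi>"
    using assms(1) unfolding emp_space_def by (rule orthogonal_to_span[rotated]) 
  then show ?thesis
    by (simp add: orthogonal_def)
qed

lemma emp_cov_onto_emp_space: "C\<^sub>N ` H\<^sub>N = H\<^sub>N"
proof (rule self_adjoint_surj)
  show "C\<^sub>N \<psi> \<bullet> \<phi> = \<psi> \<bullet> C\<^sub>N \<phi>" for \<psi> \<phi>
    by (rule emp_cov_self_adjoint)
  show "\<psi> = 0" if "\<psi> \<in> H\<^sub>N" "C\<^sub>N \<psi> = 0" for \<psi>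
    by (rule emp_cov_inj_on_emp_space[OF that])
  show "C\<^sub>N ` H\<^sub>N \<subseteq> H\<^sub>N"
    using emp_cov_in_emp_space by blast
qed (rule subspace_emp_space linear_emp_cov)+

lemma emp_cov_inv_in_emp_space: "I\<^sub>N \<psi> \<in> H\<^sub>N"
  and emp_cov_emp_cov_inv: "C\<^sub>N (I\<^sub>N \<psi>) = orth_proj H\<^sub>N \<psi>"
proof -
  have "orth_proj H\<^sub>N \<psi> \<in> C\<^sub>N ` H\<^sub>N"
    unfolding emp_cov_onto_emp_space by (rule orth_proj_mem[OF subspace_emp_space])
  then show "I\<^sub>N \<psi> \<in> H\<^sub>N" "C\<^sub>N (I\<^sub>N \<psi>) = orth_proj H\<^sub>N \<psi>"
    unfolding emp_cov_inv_def by (auto intro: inv_into_into f_inv_into_f)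
qed

lemma emp_cov_inv_eqI:
  assumes "g \<in> H\<^sub>N" "C\<^sub>N g = orth_proj H\<^sub>N \<psi>"
  shows "I\<^sub>N \<psi> = g"
proof -
  have "C\<^sub>N (I\<^sub>N \<psi> - g) = 0"
    using assms(2) by (simp add: linear_diff[OF linear_emp_cov] emp_cov_emp_cov_inv)
  then have "I\<^sub>N \<psi> - g = 0"
    by (rule emp_cov_inj_on_emp_space[OF subspace_diff[OF subspace_emp_space emp_cov_inv_in_emp_space assms(1)]])
  then show ?thesis by simp
qed

lemma linear_emp_cov_inv: "linear I\<^sub>N"
proof (rule linearI)
  note [simp] = linear_add[OF linear_emp_cov] linear_scale[OF linear_emp_cov]
    linear_add[OF linear_orth_proj[OF subspace_emp_space]] linear_scale[OF linear_orth_proj[OF subspace_emp_space]]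
  show "I\<^sub>N (\<psi> + \<phi>) = I\<^sub>N \<psi> + I\<^sub>N \<phi>" for \<psi> \<phi>
    by (intro emp_cov_inv_eqI subspace_add subspace_emp_space emp_cov_inv_in_emp_space)
      (simp add: emp_cov_emp_cov_inv)
  show "I\<^sub>N (c *\<^sub>R \<psi>) = c *\<^sub>R I\<^sub>N \<psi>" for c \<psi>
    by (intro emp_cov_inv_eqI subspace_scale subspace_emp_space emp_cov_inv_in_emp_space)
      (simp add: emp_cov_emp_cov_inv)
qed

lemma linear_emp_koopman: "linear U\<^sub>N"
  unfolding emp_koopman_def by (rule linear_compose[OF linear_emp_cross_cov linear_emp_cov_inv])

lemma linear_emp_lift_back: "linear B\<^sub>N"
  unfolding emp_lift_back_def by (rule linear_compose[OF linear_emp_cov_inv linear_emp_cov_id])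

lemma norm_average_le:
  fixes g :: "nat \<Rightarrow> 'b::real_normed_vector"
  assumes "\<And>i. norm (g i) \<le> c"
  shows "norm ((1 / real N) *\<^sub>R (\<Sum>i<N. g i)) \<le> c"
proof -
  have "norm (\<Sum>i<N. g i) \<le> (\<Sum>i<N. c)"
    by (rule order_trans[OF norm_sum sum_mono]) (rule assms)
  then show ?thesis
    using N_pos by (simp add: field_simps)
qed

lemma emp_cross_cov_norm_le: "norm (D\<^sub>N \<psi>) \<le> K * norm \<psi>"
  unfolding emp_cross_cov_def tensor_feature_def
  by (intro norm_average_le norm_evl_feature_le)

lemma emp_cov_id_norm_le: "norm (emp_cov_id evl N z \<psi>) \<le> sqrt K * norm \<psi> * R"
  unfolding emp_cov_id_def tensor_feature_def
  by (intro norm_average_le norm_evl_id_le)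

lemma emp_cov_lower_bound_ex: "\<exists>M\<ge>0. \<forall>\<psi>\<in>H\<^sub>N. norm \<psi> \<le> M * norm (C\<^sub>N \<psi>)"
proof -
  obtain M where "M \<ge> 0" "\<And>\<psi>. \<psi> \<in> H\<^sub>N \<Longrightarrow> norm \<psi> \<le> M * norm (C\<^sub>N \<psi>)"
  proof (rule self_adjoint_lower_bound_ex[of H\<^sub>N C\<^sub>N])
    show "C\<^sub>N \<psi> \<bullet> \<phi> = \<psi> \<bullet> C\<^sub>N \<phi>" for \<psi> \<phi>
      by (rule emp_cov_self_adjoint)
    show "\<psi> = 0" if "\<psi> \<in> H\<^sub>N" "C\<^sub>N \<psi> = 0" for \<psi>
      by (rule emp_cov_inj_on_emp_space[OF that])
    show "C\<^sub>N ` H\<^sub>N \<subseteq> H\<^sub>N"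
      using emp_cov_in_emp_space by blast
  qed (simp_all add: subspace_emp_space linear_emp_cov)
  then show ?thesis by blast
qed

context
  fixes M :: real
  assumes M_nonneg: "0 \<le> M"
    and lower_bound: "\<And>\<psi>. \<psi> \<in> H\<^sub>N \<Longrightarrow> norm \<psi> \<le> M * norm (C\<^sub>N \<psi>)"
begin

lemma emp_cov_inv_norm_le: "norm (I\<^sub>N \<psi>) \<le> M * norm \<psi>"
proof -
  have "norm (I\<^sub>N \<psi>) \<le> M * norm (orth_proj H\<^sub>N \<psi>)"
    using lower_bound[OF emp_cov_inv_in_emp_space[of \<psi>]] by (simp add: emp_cov_emp_cov_inv)
  also have "\<dots> \<le> M * norm \<psi>"
    by (intro mult_left_mono orth_proj_norm_le subspace_emp_space M_nonneg)
  finally show ?thesis .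
qed

lemma emp_koopman_norm_le: "norm (U\<^sub>N \<psi>) \<le> M * K * norm \<psi>"
proof -
  have "norm (U\<^sub>N \<psi>) \<le> M * norm (D\<^sub>N \<psi>)"
    unfolding emp_koopman_def comp_def by (rule emp_cov_inv_norm_le)
  also have "\<dots> \<le> M * (K * norm \<psi>)"
    by (intro mult_left_mono emp_cross_cov_norm_le M_nonneg)
  finally show ?thesis by simp
qed

lemma emp_lift_back_norm_le: "norm (B\<^sub>N \<psi>) \<le> sqrt K * M * R * norm \<psi>"
proof -
  have "norm (B\<^sub>N \<psi>) \<le> sqrt K * norm (I\<^sub>N \<psi>) * R"
    unfolding emp_lift_back_def comp_def by (rule emp_cov_id_norm_le)
  also have "\<dots> \<le> sqrt K * (M * norm \<psi>) * R"
    using K_pos R_nonneg by (intro mult_left_mono mult_right_mono emp_cov_inv_norm_le) auto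
  finally show ?thesis by (simp add: mult_ac)
qed

end

text \<open>Once \<open>C\<^sup>N\<close> is coercive on the whole space, \<open>H\<^sub>N\<close> is everything, the empirical lifting-back
  operator is exact, and the only error left is that of \<open>U\<^sub>N\<close>.\<close>

context
  fixes c :: real
  assumes c_pos: "0 < c" and emp_coercive: "\<And>\<psi>. c * norm \<psi> \<le> norm (C\<^sub>N \<psi>)"
begin

lemma emp_space_eq_UNIV: "H\<^sub>N = UNIV"
proof -
  have "C\<^sub>N ` UNIV = UNIV"
  proof (rule self_adjoint_surj)
    show "C\<^sub>N \<psi> \<bullet> \<phi> = \<psi> \<bullet> C\<^sub>N \<phi>" for \<psi> \<phi>
      by (rule emp_cov_self_adjoint)
    show "\<psi> = 0" if "C\<^sub>N \<psi> = 0" for \<psi>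
      using emp_coercive[of \<psi>] c_pos that by (simp add: mult_le_0_iff)
  qed (simp_all add: linear_emp_cov)
  then show ?thesis
    using emp_cov_in_emp_space by (metis UNIV_eq_I surjD)
qed

lemma emp_cov_inv_exact: "C\<^sub>N (I\<^sub>N \<psi>) = \<psi>"
proof -
  have "orth_proj H\<^sub>N \<psi> = \<psi>"
    by (rule orth_proj_eqI[OF subspace_emp_space]) (simp_all add: emp_space_eq_UNIV)
  then show ?thesis
    by (simp add: emp_cov_emp_cov_inv)
qed

text \<open>The computation of \<open>lift_back_inner\<close> with the empirical measure in place of \<open>\<mu>\<close>.\<close>

lemma emp_lift_back_exact: "B\<^sub>N \<psi> = B \<psi>"
proof (rule vector_eq_ldot[THEN iffD1], rule allI)
  fix v
  have "v \<bullet> B\<^sub>N \<psi> = C\<^sub>N (I\<^sub>N \<psi>) \<bullet> coord v"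
    by (simp add: emp_cov_inner emp_lift_back_def emp_cov_id_def tensor_feature_def
        inner_sum_right evl_mult_coord)
  then show "v \<bullet> B\<^sub>N \<psi> = v \<bullet> B \<psi>"
    by (simp add: emp_cov_inv_exact lift_back_inner)
qed

text \<open>Apply \<open>C\<^sup>N\<close> to the error; coercivity undoes this up to the factor \<open>1 / c\<close>.\<close>

lemma emp_koopman_error: "norm (U\<^sub>N \<psi> - U \<psi>) \<le> norm (D\<^sub>N \<psi> - C\<^sub>N (U \<psi>)) / c"
proof -
  have "C\<^sub>N (U\<^sub>N \<psi> - U \<psi>) = D\<^sub>N \<psi> - C\<^sub>N (U \<psi>)"
    by (simp add: linear_diff[OF linear_emp_cov] emp_koopman_def emp_cov_inv_exact)
  then show ?thesis
    using emp_coercive[of "U\<^sub>N \<psi> - U \<psi>"] c_pos by (simp only: pos_le_divide_eq mult.commute)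
qed

end

end

end

section \<open>Concentration of empirical means\<close>

lemma (in prob_space) prob_Int_ge:
  assumes "A \<in> events" "B \<in> events" "1 - a \<le> prob A" "1 - b \<le> prob B"
  shows "1 - (a + b) \<le> prob (A \<inter> B)"
proof -
  have "prob (A \<union> B) = prob A + prob B - prob (A \<inter> B)"
    using assms by (intro measure_Un3) (auto simp: fmeasurable_eq_sets)
  moreover have "prob (A \<union> B) \<le> 1"
    by simp
  ultimately show ?thesis
    using assms by simp
qed

text \<open>Hoeffding's inequality at the deviation for which its bound is \<open>2 exp (- 2 / \<epsilon>)\<close>, which is at
  most \<open>\<epsilon>\<close> because \<open>exp t \<ge> t\<close>.\<close>

lemma (in prob_space) average_concentration:
  fixes Y :: "nat \<Rightarrow> 'a \<Rightarrow> real"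
  assumes indep: "indep_vars (\<lambda>_. borel) Y UNIV"
    and bound: "\<And>i s. \<bar>Y i s\<bar> \<le> c" and c: "0 < c"
    and mean: "\<And>i. expectation (Y i) = 0"
    and \<epsilon>: "0 < \<epsilon>" and N: "0 < N"
  shows "\<exists>A\<in>events. 1 - \<epsilon> \<le> prob A \<and>
    (\<forall>s\<in>A. \<bar>(1 / real N) * (\<Sum>i<N. Y i s)\<bar> \<le> 2 * c / sqrt \<epsilon> / sqrt (real N))"
proof -
  interpret H: Hoeffding_ineq M "{..<N}" Y "\<lambda>_. - c" "\<lambda>_. c" 0
  proof unfold_locales
    show "indep_vars (\<lambda>_. borel) Y {..<N}"
      by (rule indep_vars_subset[OF indep]) simp
    show "AE x in M. Y i x \<in> {- c..c}" for i
      using bound by (auto simp: abs_le_iff minus_le_iff)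
    show "0 \<equiv> \<Sum>i\<in>{..<N}. expectation (Y i)"
      by (simp add: mean)
  qed simp
  define \<eta> where "\<eta> = 2 * c / sqrt \<epsilon> * sqrt (real N)"
  define F where "F = {s \<in> space M. \<eta> \<le> \<bar>(\<Sum>i<N. Y i s) - 0\<bar>}"
  have Y_meas: "Y i \<in> borel_measurable M" for i
    using indep by (auto simp: indep_vars_def)
  have F: "F \<in> events"
    unfolding F_def using Y_meas by measurable
  have "prob F \<le> 2 * exp (- 2 * \<eta>\<^sup>2 / (\<Sum>i<N. (c - - c)\<^sup>2))"
    unfolding F_def by (rule H.Hoeffding_ineq_abs_ge) (use c N \<epsilon> in \<open>auto simp: \<eta>_def\<close>)
  also have "- 2 * \<eta>\<^sup>2 / (\<Sum>i<N. (c - - c)\<^sup>2) = - (2 / \<epsilon>)"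
    using c N \<epsilon> by (simp add: \<eta>_def power_mult_distrib power_divide field_simps)
  also have "2 * exp (- (2 / \<epsilon>)) \<le> \<epsilon>"
  proof -
    have "2 / \<epsilon> \<le> exp (2 / \<epsilon>)"
      using exp_ge_add_one_self[of "2 / \<epsilon>"] by linarith
    then show ?thesis
      using \<epsilon> by (simp add: exp_minus field_simps)
  qed
  finally have PF: "prob F \<le> \<epsilon>" .
  show ?thesis
  proof (intro bexI conjI ballI)
    show "space M - F \<in> events"
      using F by auto
    show "1 - \<epsilon> \<le> prob (space M - F)"
      using PF F by (simp add: prob_compl)
    fix s assume "s \<in> space M - F"
    then have "\<bar>\<Sum>i<N. Y i s\<bar> \<le> \<eta>"
      by (auto simp: F_def)
    then have "\<bar>\<Sum>i<N. Y i s\<bar> / real N \<le> \<eta> / real N"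
      by (intro divide_right_mono) auto
    also have "\<eta> / real N = 2 * c / sqrt \<epsilon> * (sqrt (real N) / (sqrt (real N) * sqrt (real N)))"
      by (simp add: \<eta>_def)
    also have "sqrt (real N) / (sqrt (real N) * sqrt (real N)) = 1 / sqrt (real N)"
      unfolding divide_divide_eq_left[symmetric] using N by simp
    finally show "\<bar>(1 / real N) * (\<Sum>i<N. Y i s)\<bar> \<le> 2 * c / sqrt \<epsilon> / sqrt (real N)"
      by simp
  qed
qed

section \<open>One step of the dynamics\<close>

lemma fst_borel_measurable [measurable]:
    "(fst :: 'a::euclidean_space \<times> 'b::euclidean_space \<Rightarrow> 'a) \<in> borel_measurable borel"
  and snd_borel_measurable [measurable]:
    "(snd :: 'a::euclidean_space \<times> 'b::euclidean_space \<Rightarrow> 'b) \<in> borel_measurable borel"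
  by (intro borel_measurable_continuous_onI continuous_intros)+

context koopman_setting
begin

text \<open>Both the sample pairs and the steps of the trajectories are a random state followed by an
  independent noise variable; these two facts serve for all of them.\<close>

lemma AE_pair_step_in_X:
  assumes P: "prob_space P" "sets P = sets borel" and PX: "AE x in P. x \<in> X"
  shows "AE p in P \<Otimes>\<^sub>M \<nu>. f (fst p) (snd p) \<in> X"
proof -
  interpret Pr: prob_space P by (rule P)
  interpret pair_prob_space P \<nu> ..
  note [measurable_cong] = P(2)
  have "{p \<in> space (P \<Otimes>\<^sub>M \<nu>). f (fst p) (snd p) \<in> X} \<in> sets (P \<Otimes>\<^sub>M \<nu>)"
    by measurable
  moreover have "AE x in P. AE u in \<nu>. f (fst (x, u)) (snd (x, u)) \<in> X"
    using PX by eventually_elim (simp add: AE_step_in_X)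
  ultimately show ?thesis
    by (rule AE_pair_measure)
qed

lemma integral_pair_step:
  assumes P: "prob_space P" "sets P = sets borel" and PX: "AE x in P. x \<in> X"
    and g [measurable]: "g \<in> borel_measurable borel" and g_le: "\<And>x. \<bar>g x\<bar> \<le> c"
  shows "(LINT p|(P \<Otimes>\<^sub>M \<nu>). g (fst p) * evl \<psi> (f (fst p) (snd p))) = (LINT x|P. g x * evl (U \<psi>) x)"
proof -
  interpret Pr: prob_space P by (rule P)
  interpret pair_prob_space P \<nu> ..
  note [measurable_cong] = P(2)
  have int: "integrable (P \<Otimes>\<^sub>M \<nu>) (\<lambda>p. g (fst p) * evl \<psi> (f (fst p) (snd p)))"
  proof (rule integrable_const_bound[where B = "c * (sqrt K * norm \<psi>)"])
    show "AE p in P \<Otimes>\<^sub>M \<nu>. norm (g (fst p) * evl \<psi> (f (fst p) (snd p))) \<le> c * (sqrt K * norm \<psi>)"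
      using order_trans[OF abs_ge_zero g_le]
      by (intro AE_I2) (auto simp: abs_mult intro!: mult_mono g_le abs_evl_le)
  qed measurable
  have "(LINT p|(P \<Otimes>\<^sub>M \<nu>). g (fst p) * evl \<psi> (f (fst p) (snd p)))
      = (LINT x|P. LINT u|\<nu>. g x * evl \<psi> (f x u))"
    using integral_fst'[OF int] by simp
  also have "\<dots> = (LINT x|P. g x * evl (U \<psi>) x)"
  proof (rule integral_cong_AE)
    show "AE x in P. (LINT u|\<nu>. g x * evl \<psi> (f x u)) = g x * evl (U \<psi>) x"
      using PX by eventually_elim (simp add: evl_koopman_eq)
  qed measurable
  finally show ?thesis .
qed

text \<open>Drawing a pair from the sample law amounts to drawing a state and an independent noise value,
  which turns integrals against the sample law into those of \<open>integral_pair_step\<close>.\<close>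

lemma sample_law_eq:
  "sample_law \<nu> f \<mu> = distr (\<mu> \<Otimes>\<^sub>M \<nu>) borel (\<lambda>p. (fst p, f (fst p) (snd p)))"
proof -
  interpret pair_prob_space \<mu> \<nu> ..
  have step: "distr (transition \<nu> f x) borel (\<lambda>x'. (x, x')) = distr \<nu> borel (\<lambda>u. (x, f x u))" for x
    unfolding transition_def by (subst distr_distr) (auto simp: comp_def)
  have ker: "(\<lambda>x. distr \<nu> borel (\<lambda>u. (x, f x u))) \<in> measurable \<mu> (subprob_algebra borel)"
  proof (rule measurable_distr2)
    show "(\<lambda>(x, u). (x, f x u)) \<in> borel_measurable (\<mu> \<Otimes>\<^sub>M \<nu>)"
      by measurable
    show "(\<lambda>x. \<nu>) \<in> measurable \<mu> (subprob_algebra \<nu>)"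
      by (simp add: space_subprob_algebra \<nu>.subprob_space_axioms)
  qed
  have \<mu>_ne: "space \<mu> \<noteq> {}"
    by (rule \<mu>.not_empty)
  show ?thesis
    unfolding sample_law_def step
  proof (rule measure_eqI)
    show "sets (\<mu> \<bind> (\<lambda>x. distr \<nu> borel (\<lambda>u. (x, f x u))))
        = sets (distr (\<mu> \<Otimes>\<^sub>M \<nu>) borel (\<lambda>p. (fst p, f (fst p) (snd p))))"
      using sets_bind[of \<mu> "\<lambda>x. distr \<nu> borel (\<lambda>u. (x, f x u))" borel] \<mu>_ne by simp
    fix A assume "A \<in> sets (\<mu> \<bind> (\<lambda>x. distr \<nu> borel (\<lambda>u. (x, f x u))))"
    then have A [measurable]: "A \<in> sets borel"
      using sets_bind[of \<mu> "\<lambda>x. distr \<nu> borel (\<lambda>u. (x, f x u))" borel] \<mu>_ne by simp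
    have m: "(\<lambda>p. (fst p, f (fst p) (snd p))) \<in> borel_measurable (\<mu> \<Otimes>\<^sub>M \<nu>)"
      by measurable
    have "emeasure (distr (\<mu> \<Otimes>\<^sub>M \<nu>) borel (\<lambda>p. (fst p, f (fst p) (snd p)))) A
        = emeasure (\<mu> \<Otimes>\<^sub>M \<nu>) ((\<lambda>p. (fst p, f (fst p) (snd p))) -` A \<inter> space (\<mu> \<Otimes>\<^sub>M \<nu>))"
      using m A by (rule emeasure_distr)
    also have "\<dots> = (\<integral>\<^sup>+x. emeasure \<nu> (Pair x -` ((\<lambda>p. (fst p, f (fst p) (snd p))) -` A \<inter> space (\<mu> \<Otimes>\<^sub>M \<nu>))) \<partial>\<mu>)"
      by (rule \<nu>.emeasure_pair_measure_alt) (rule measurable_sets[OF m A])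
    also have "\<dots> = (\<integral>\<^sup>+x. emeasure (distr \<nu> borel (\<lambda>u. (x, f x u))) A \<partial>\<mu>)"
    proof (rule nn_integral_cong)
      fix x assume x: "x \<in> space \<mu>"
      have "emeasure (distr \<nu> borel (\<lambda>u. (x, f x u))) A = emeasure \<nu> ((\<lambda>u. (x, f x u)) -` A \<inter> space \<nu>)"
        by (rule emeasure_distr) measurable
      also have "(\<lambda>u. (x, f x u)) -` A \<inter> space \<nu>
          = Pair x -` ((\<lambda>p. (fst p, f (fst p) (snd p))) -` A \<inter> space (\<mu> \<Otimes>\<^sub>M \<nu>))"
        using x by (auto simp: space_pair_measure)
      finally show "emeasure \<nu> (Pair x -` ((\<lambda>p. (fst p, f (fst p) (snd p))) -` A \<inter> space (\<mu> \<Otimes>\<^sub>M \<nu>)))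
          = emeasure (distr \<nu> borel (\<lambda>u. (x, f x u))) A" by simp
    qed
    also have "\<dots> = emeasure (\<mu> \<bind> (\<lambda>x. distr \<nu> borel (\<lambda>u. (x, f x u)))) A"
      by (rule emeasure_bind[OF \<mu>_ne ker A, symmetric])
    finally show "emeasure (\<mu> \<bind> (\<lambda>x. distr \<nu> borel (\<lambda>u. (x, f x u)))) A
        = emeasure (distr (\<mu> \<Otimes>\<^sub>M \<nu>) borel (\<lambda>p. (fst p, f (fst p) (snd p)))) A" by simp
  qed
qed

lemma integral_sample_law:
  assumes [measurable]: "g \<in> borel_measurable borel"
  shows "(LINT p|sample_law \<nu> f \<mu>. g p) = (LINT p|(\<mu> \<Otimes>\<^sub>M \<nu>). (g (fst p, f (fst p) (snd p)) :: real))"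
  unfolding sample_law_eq by (rule integral_distr) measurable

text \<open>The centred statistics whose averages over the sample are the matrix entries of \<open>C\<^sup>N - C\<close> and
  of \<open>C\<^sub>X\<^sub>X\<^sub>+\<^sup>N - C\<^sup>N U\<close>.\<close>

definition cov_dev :: "'h \<Rightarrow> 'h \<Rightarrow> 'a \<times> 'a \<Rightarrow> real" where
  "cov_dev \<psi> \<phi> p = evl \<psi> (fst p) * evl \<phi> (fst p) - C \<psi> \<bullet> \<phi>"

definition koopman_dev :: "'h \<Rightarrow> 'h \<Rightarrow> 'a \<times> 'a \<Rightarrow> real" where
  "koopman_dev \<psi> \<phi> p = evl \<psi> (snd p) * evl \<phi> (fst p) - evl (U \<psi>) (fst p) * evl \<phi> (fst p)"

lemma dev_measurable [measurable]:
  "cov_dev \<psi> \<phi> \<in> borel_measurable borel" "koopman_dev \<psi> \<phi> \<in> borel_measurable borel"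
  unfolding cov_dev_def[abs_def] koopman_dev_def[abs_def] by measurable

lemma abs_evl_mult_le: "\<bar>evl \<psi> x * evl \<phi> y\<bar> \<le> (sqrt K * norm \<psi>) * (sqrt K * norm \<phi>)"
  unfolding abs_mult using K_pos by (intro mult_mono abs_evl_le) auto

lemma dev_bounded: "\<exists>c. \<forall>p. \<bar>cov_dev \<psi> \<phi> p\<bar> \<le> c" "\<exists>c. \<forall>p. \<bar>koopman_dev \<psi> \<phi> p\<bar> \<le> c"
proof -
  show "\<exists>c. \<forall>p. \<bar>cov_dev \<psi> \<phi> p\<bar> \<le> c"
    unfolding cov_dev_def
    by (rule exI, rule allI, rule order_trans[OF abs_triangle_ineq4], rule add_mono[OF abs_evl_mult_le order_refl])
  show "\<exists>c. \<forall>p. \<bar>koopman_dev \<psi> \<phi> p\<bar> \<le> c"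
    unfolding koopman_dev_def
    by (rule exI, rule allI, rule order_trans[OF abs_triangle_ineq4], rule add_mono[OF abs_evl_mult_le abs_evl_mult_le])
qed

lemma cov_dev_mean: "(LINT p|sample_law \<nu> f \<mu>. cov_dev \<psi> \<phi> p) = 0"
proof -
  interpret pair_prob_space \<mu> \<nu> ..
  have int: "integrable (\<mu> \<Otimes>\<^sub>M \<nu>) (\<lambda>p. evl \<psi> (fst p) * evl \<phi> (fst p))"
    by (rule integrable_const_bound) (auto intro: abs_evl_mult_le)
  have "(LINT p|sample_law \<nu> f \<mu>. cov_dev \<psi> \<phi> p)
      = (LINT p|(\<mu> \<Otimes>\<^sub>M \<nu>). evl \<psi> (fst p) * evl \<phi> (fst p) - C \<psi> \<bullet> \<phi>)"
    by (subst integral_sample_law) (simp_all add: cov_dev_def)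
  also have "\<dots> = (LINT p|(\<mu> \<Otimes>\<^sub>M \<nu>). evl \<psi> (fst p) * evl \<phi> (fst p)) - C \<psi> \<bullet> \<phi>"
    using int by (simp add: prob_space)
  also have "(LINT p|(\<mu> \<Otimes>\<^sub>M \<nu>). evl \<psi> (fst p) * evl \<phi> (fst p)) = C \<psi> \<bullet> \<phi>"
    using integral_fst'[OF int] by (simp add: cov_inner \<nu>.prob_space)
  finally show ?thesis by simp
qed

lemma koopman_dev_mean: "(LINT p|sample_law \<nu> f \<mu>. koopman_dev \<psi> \<phi> p) = 0"
proof -
  interpret pair_prob_space \<mu> \<nu> ..
  have int: "integrable (\<mu> \<Otimes>\<^sub>M \<nu>) (\<lambda>p. evl \<phi> (fst p) * evl (U \<psi>) (fst p))"
    by (rule integrable_const_bound) (auto intro: abs_evl_mult_le)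
  have int': "integrable (\<mu> \<Otimes>\<^sub>M \<nu>) (\<lambda>p. evl \<phi> (fst p) * evl \<psi> (f (fst p) (snd p)))"
    by (rule integrable_const_bound) (auto intro: abs_evl_mult_le)
  have "(LINT p|sample_law \<nu> f \<mu>. koopman_dev \<psi> \<phi> p)
      = (LINT p|(\<mu> \<Otimes>\<^sub>M \<nu>). evl \<phi> (fst p) * evl \<psi> (f (fst p) (snd p)) - evl \<phi> (fst p) * evl (U \<psi>) (fst p))"
    by (subst integral_sample_law) (simp_all add: koopman_dev_def mult.commute)
  also have "\<dots> = (LINT x|\<mu>. evl \<phi> x * evl (U \<psi>) x) - (LINT p|(\<mu> \<Otimes>\<^sub>M \<nu>). evl \<phi> (fst p) * evl (U \<psi>) (fst p))"
    unfolding Bochner_Integration.integral_diff[OF int' int]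
    by (subst integral_pair_step[OF prob_\<mu> sets_\<mu> AE_\<mu>_in_X evl_measurable abs_evl_le]) (rule refl)
  also have "(LINT p|(\<mu> \<Otimes>\<^sub>M \<nu>). evl \<phi> (fst p) * evl (U \<psi>) (fst p)) = (LINT x|\<mu>. evl \<phi> x * evl (U \<psi>) x)"
    using integral_fst'[OF int] by (simp add: \<nu>.prob_space)
  finally show ?thesis by simp
qed

end

section \<open>Operator errors with high probability\<close>

lemma span_image_lessThan_explicit:
  fixes g :: "nat \<Rightarrow> 'b::real_vector"
  assumes "\<psi> \<in> span (g ` {..<N})"
  shows "\<exists>a. \<psi> = (\<Sum>i<N. a i *\<^sub>R g i)"
  using assms
proof (induction rule: span_induct_alt)
  case base
  show ?case
    by (rule exI[of _ "\<lambda>_. 0"]) simp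
next
  case (step c x y)
  then obtain j a where j: "j < N" "x = g j" and a: "y = (\<Sum>i<N. a i *\<^sub>R g i)"
    by auto
  have "c *\<^sub>R x + y = (\<Sum>i<N. (a i + (if i = j then c else 0)) *\<^sub>R g i)"
    using j by (simp add: a scaleR_add_left sum.distrib if_distrib[of "\<lambda>c. c *\<^sub>R _"] cong: if_cong)
  then show ?case
    by (intro exI[of _ "\<lambda>i. a i + (if i = j then c else 0)"])
qed

text \<open>Rational approximation reduces lower bounds on \<open>C\<^sup>N\<close> over \<open>H\<^sub>N\<close> to countably many conditions, so
  that they define an event.\<close>

lemma rational_sequence_ex: "\<exists>q. (\<forall>n. q n \<in> \<rat>) \<and> q \<longlonglongrightarrow> (r::real)"
proof -
  have "\<exists>q\<in>\<rat>. r < q \<and> q < r + 1 / real (Suc n)" for n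
    by (rule Rats_dense_in_real) simp
  then obtain q where q: "\<And>n. q n \<in> \<rat>" "\<And>n. r < q n" "\<And>n. q n < r + 1 / real (Suc n)"
    by metis
  have "(\<lambda>n. r + 1 / real (Suc n)) \<longlonglongrightarrow> r + 0"
    by (intro tendsto_intros LIMSEQ_Suc lim_1_over_n)
  then have "q \<longlonglongrightarrow> r"
    using q by (intro tendsto_sandwich[of "\<lambda>_. r" q _ "\<lambda>n. r + 1 / real (Suc n)"])
      (auto intro!: always_eventually less_imp_le)
  then show ?thesis
    using q(1) by blast
qed

context koopman_setting
begin

lemma emp_cov_eq:
  "C\<^sub>N N y \<psi> = (1 / real N) *\<^sub>R (\<Sum>i<N. (\<psi> \<bullet> \<Phi> (fst (y i))) *\<^sub>R \<Phi> (fst (y i)))"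
  by (simp add: emp_cov_def tensor_feature_def evl_inner)

lemma emp_cov_deviation:
  assumes "0 < N"
  shows "(C\<^sub>N N y \<psi> - C \<psi>) \<bullet> \<phi> = (1 / real N) * (\<Sum>i<N. cov_dev \<psi> \<phi> (y i))"
  using assms by (simp add: cov_dev_def inner_diff_left emp_cov_inner sum_subtractf field_simps)

lemma emp_cross_cov_deviation:
  assumes "0 < N"
  shows "(D\<^sub>N N y \<psi> - C\<^sub>N N y (U \<psi>)) \<bullet> \<phi> = (1 / real N) * (\<Sum>i<N. koopman_dev \<psi> \<phi> (y i))"
  using assms
  by (simp add: koopman_dev_def inner_diff_left emp_cov_inner emp_cross_cov_inner sum_subtractf
      right_diff_distrib)

lemma emp_cov_lower_bound_of_rational:
  assumes N: "0 < N"
    and rat: "\<And>a. a \<in> PiE {..<N} (\<lambda>_. \<rat>) \<Longrightarrow>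
      norm (\<Sum>i<N. a i *\<^sub>R \<Phi> (fst (y i))) \<le> M * norm (C\<^sub>N N y (\<Sum>i<N. a i *\<^sub>R \<Phi> (fst (y i))))"
    and \<psi>: "\<psi> \<in> H\<^sub>N N y"
  shows "norm \<psi> \<le> M * norm (C\<^sub>N N y \<psi>)"
proof -
  obtain a where a: "\<psi> = (\<Sum>i<N. a i *\<^sub>R \<Phi> (fst (y i)))"
    using span_image_lessThan_explicit \<psi> unfolding emp_space_def by metis
  obtain q where q: "\<And>i n. q i n \<in> \<rat>" "\<And>i. q i \<longlonglongrightarrow> a i"
  proof -
    have "\<forall>i. \<exists>q. (\<forall>n. q n \<in> \<rat>) \<and> q \<longlonglongrightarrow> a i"
      by (intro allI rational_sequence_ex)
    then have "\<exists>q. \<forall>i. (\<forall>n. q i n \<in> \<rat>) \<and> q i \<longlonglongrightarrow> a i"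
      by (rule choice)
    then show ?thesis
      using that by blast
  qed
  define g where "g n = (\<Sum>i<N. q i n *\<^sub>R \<Phi> (fst (y i)))" for n
  have g: "g \<longlonglongrightarrow> \<psi>"
    unfolding g_def a by (intro tendsto_intros q)
  have Cg: "(\<lambda>n. C\<^sub>N N y (g n)) \<longlonglongrightarrow> C\<^sub>N N y \<psi>"
    unfolding emp_cov_eq
    by (rule tendsto_scaleR[OF tendsto_const], rule tendsto_sum,
        rule tendsto_scaleR[OF tendsto_inner[OF g tendsto_const] tendsto_const])
  have le: "norm (g n) \<le> M * norm (C\<^sub>N N y (g n))" for n
  proof -
    have "restrict (\<lambda>i. q i n) {..<N} \<in> PiE {..<N} (\<lambda>_. \<rat>)"
      using q(1) by auto
    from rat[OF this] show ?thesis
      by (simp add: g_def)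
  qed
  show ?thesis
    by (rule LIMSEQ_le[OF tendsto_norm[OF g] tendsto_mult_left[OF tendsto_norm[OF Cg]]])
      (use le in auto)
qed

end

locale koopman_sampling = koopman_setting X k evl K E \<mu> c1 \<nu> f R
  for X :: "'a::euclidean_space set" and k
    and evl :: "'h::{real_inner, banach, second_countable_topology} \<Rightarrow> 'a \<Rightarrow> real" and K
    and E :: "'h set" and \<mu> c1 and \<nu> :: "'w measure" and f and R +
  fixes S :: "'s measure" and z :: "nat \<Rightarrow> 's \<Rightarrow> 'a \<times> 'a"
  assumes prob_S: "prob_space S"
    and z_indep: "prob_space.indep_vars S (\<lambda>_. borel) z UNIV"
    and z_law: "\<And>i. distr S borel (z i) = sample_law \<nu> f \<mu>"
begin

sublocale S: prob_space S by (rule prob_S)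

lemma z_measurable [measurable]: "z i \<in> borel_measurable S"
  using z_indep unfolding S.indep_vars_def by blast

text \<open>A union bound over the finite family, organised as an induction that halves the admissible
  failure probability at each step.\<close>

lemma dev_concentration:
  assumes "finite T" and \<epsilon>: "0 < \<epsilon>"
    and T: "\<And>h. h \<in> T \<Longrightarrow> h \<in> borel_measurable borel \<and> (\<exists>c. \<forall>p. \<bar>h p\<bar> \<le> c) \<and>
      (LINT p|sample_law \<nu> f \<mu>. h p) = (0::real)"
  shows "\<exists>t\<ge>0. \<forall>N>0. \<exists>A\<in>S.events. 1 - \<epsilon> \<le> S.prob A \<and>
    (\<forall>s\<in>A. \<forall>h\<in>T. \<bar>(1 / real N) * (\<Sum>i<N. h (z i s))\<bar> \<le> t / sqrt (real N))"
  using assms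
proof (induction arbitrary: \<epsilon> rule: finite_induct)
  case empty
  have "\<exists>A\<in>S.events. 1 - \<epsilon> \<le> S.prob A"
    using empty by (intro bexI[of _ "space S"]) (auto simp: S.prob_space)
  then show ?case
    by auto
next
  case (insert h T)
  from insert.IH[of "\<epsilon> / 2"] insert.prems
  obtain t where t: "t \<ge> 0" "\<And>N. 0 < N \<Longrightarrow> \<exists>A\<in>S.events. 1 - \<epsilon> / 2 \<le> S.prob A \<and>
    (\<forall>s\<in>A. \<forall>h\<in>T. \<bar>(1 / real N) * (\<Sum>i<N. h (z i s))\<bar> \<le> t / sqrt (real N))"
    by auto
  from insert.prems(2)[of h] obtain c0 where
    h: "h \<in> borel_measurable borel" "\<And>p. \<bar>h p\<bar> \<le> c0" "(LINT p|sample_law \<nu> f \<mu>. h p) = 0"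
    by auto
  define c where "c = \<bar>c0\<bar> + 1"
  have c: "c > 0" "\<And>p. \<bar>h p\<bar> \<le> c"
    using h(2) by (auto simp: c_def intro: order_trans[OF h(2)])
  have indep: "S.indep_vars (\<lambda>_. borel) (\<lambda>i s. h (z i s)) UNIV"
    by (rule S.indep_vars_compose2[OF z_indep]) (rule h(1))
  have mean: "S.expectation (\<lambda>s. h (z i s)) = 0" for i
    using integral_distr[OF z_measurable h(1), of i] by (simp add: z_law h(3))
  define t' where "t' = max t (2 * c / sqrt (\<epsilon> / 2))"
  show ?case
  proof (intro exI[of _ t'] conjI allI impI)
    show "0 \<le> t'"
      using t(1) by (simp add: t'_def)
    fix N :: nat assume N: "0 < N"
    from t(2)[OF N] obtain A where A: "A \<in> S.events" "1 - \<epsilon> / 2 \<le> S.prob A"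
      "\<And>s h. s \<in> A \<Longrightarrow> h \<in> T \<Longrightarrow> \<bar>(1 / real N) * (\<Sum>i<N. h (z i s))\<bar> \<le> t / sqrt (real N)"
      by blast
    from S.average_concentration[OF indep c(2,1) mean _ N, of "\<epsilon> / 2"] insert.prems(1)
    obtain A' where A': "A' \<in> S.events" "1 - \<epsilon> / 2 \<le> S.prob A'"
      "\<And>s. s \<in> A' \<Longrightarrow> \<bar>(1 / real N) * (\<Sum>i<N. h (z i s))\<bar> \<le> 2 * c / sqrt (\<epsilon> / 2) / sqrt (real N)"
      by auto
    have mono: "t / sqrt (real N) \<le> t' / sqrt (real N)"
      "2 * c / sqrt (\<epsilon> / 2) / sqrt (real N) \<le> t' / sqrt (real N)"
      by (intro divide_right_mono; simp add: t'_def)+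
    show "\<exists>A\<in>S.events. 1 - \<epsilon> \<le> S.prob A \<and>
      (\<forall>s\<in>A. \<forall>h\<in>insert h T. \<bar>(1 / real N) * (\<Sum>i<N. h (z i s))\<bar> \<le> t' / sqrt (real N))"
    proof (intro bexI[of _ "A \<inter> A'"] conjI ballI)
      show "1 - \<epsilon> \<le> S.prob (A \<inter> A')"
        using S.prob_Int_ge[OF A(1) A'(1) A(2) A'(2)] by simp
      show "A \<inter> A' \<in> S.events"
        using A(1) A'(1) by auto
      fix s g assume s: "s \<in> A \<inter> A'" and g: "g \<in> insert h T"
      show "\<bar>(1 / real N) * (\<Sum>i<N. g (z i s))\<bar> \<le> t' / sqrt (real N)"
      proof (cases "g = h")
        case True
        then show ?thesis
          using order_trans[OF A'(3) mono(2)] s by blast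
      next
        case False
        then show ?thesis
          using order_trans[OF A(3) mono(1)] s g by blast
      qed
    qed
  qed
qed

lemma emp_operators_concentration:
  assumes \<epsilon>: "0 < \<epsilon>"
  shows "\<exists>t\<ge>0. \<forall>N>0. \<exists>A\<in>S.events. 1 - \<epsilon> \<le> S.prob A \<and>
    (\<forall>s\<in>A. \<forall>\<psi>. norm (C\<^sub>N N (\<lambda>i. z i s) \<psi> - C \<psi>) \<le> t / sqrt (real N) * norm \<psi> \<and>
      norm (D\<^sub>N N (\<lambda>i. z i s) \<psi> - C\<^sub>N N (\<lambda>i. z i s) (U \<psi>)) \<le> t / sqrt (real N) * norm \<psi>)"
proof -
  define T where "T = (\<lambda>(b, b'). cov_dev b b') ` (E \<times> E) \<union> (\<lambda>(b, b'). koopman_dev b b') ` (E \<times> E)"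
  have "finite T"
    by (simp add: T_def)
  moreover have "h \<in> borel_measurable borel \<and> (\<exists>c. \<forall>p. \<bar>h p\<bar> \<le> c) \<and> (LINT p|sample_law \<nu> f \<mu>. h p) = 0"
    if "h \<in> T" for h
    using that dev_measurable dev_bounded cov_dev_mean koopman_dev_mean by (auto simp: T_def)
  ultimately obtain t where t: "t \<ge> 0" "\<And>N. 0 < N \<Longrightarrow> \<exists>A\<in>S.events. 1 - \<epsilon> \<le> S.prob A \<and>
    (\<forall>s\<in>A. \<forall>h\<in>T. \<bar>(1 / real N) * (\<Sum>i<N. h (z i s))\<bar> \<le> t / sqrt (real N))"
    using dev_concentration[of T \<epsilon>] \<epsilon> by metis
  let ?d = "real (card E)"
  show ?thesis
  proof (intro exI[of _ "?d * (?d * t)"] conjI allI impI)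
    show "0 \<le> ?d * (?d * t)"
      using t(1) by simp
    fix N :: nat assume N: "0 < N"
    from t(2)[OF N] obtain A where A: "A \<in> S.events" "1 - \<epsilon> \<le> S.prob A"
      "\<And>s h. s \<in> A \<Longrightarrow> h \<in> T \<Longrightarrow> \<bar>(1 / real N) * (\<Sum>i<N. h (z i s))\<bar> \<le> t / sqrt (real N)"
      by blast
    have "norm (C\<^sub>N N (\<lambda>i. z i s) \<psi> - C \<psi>) \<le> ?d * (?d * t) / sqrt (real N) * norm \<psi> \<and>
      norm (D\<^sub>N N (\<lambda>i. z i s) \<psi> - C\<^sub>N N (\<lambda>i. z i s) (U \<psi>)) \<le> ?d * (?d * t) / sqrt (real N) * norm \<psi>"
      if s: "s \<in> A" for s \<psi>
    proof -
      have "\<bar>(C\<^sub>N N (\<lambda>i. z i s) b - C b) \<bullet> b'\<bar> \<le> t / sqrt (real N)" if "b \<in> E" "b' \<in> E" for b b'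
        unfolding emp_cov_deviation[OF N] using that by (intro A(3)[OF s]) (auto simp: T_def)
      then have 1: "norm (C\<^sub>N N (\<lambda>i. z i s) b - C b) \<le> ?d * (t / sqrt (real N))" if "b \<in> E" for b
        using that by (intro norm_le_of_coords)
      have "\<bar>(D\<^sub>N N (\<lambda>i. z i s) b - C\<^sub>N N (\<lambda>i. z i s) (U b)) \<bullet> b'\<bar> \<le> t / sqrt (real N)"
        if "b \<in> E" "b' \<in> E" for b b'
        unfolding emp_cross_cov_deviation[OF N] using that by (intro A(3)[OF s]) (auto simp: T_def)
      then have 2: "norm (D\<^sub>N N (\<lambda>i. z i s) b - C\<^sub>N N (\<lambda>i. z i s) (U b)) \<le> ?d * (t / sqrt (real N))"
        if "b \<in> E" for b
        using that by (intro norm_le_of_coords)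
      have L1: "linear (\<lambda>\<psi>. C\<^sub>N N (\<lambda>i. z i s) \<psi> - C \<psi>)"
        by (intro linear_compose_sub linear_emp_cov N linear_cov)
      have L2: "linear (\<lambda>\<psi>. D\<^sub>N N (\<lambda>i. z i s) \<psi> - C\<^sub>N N (\<lambda>i. z i s) (U \<psi>))"
        using linear_compose[OF linear_koopman linear_emp_cov[OF N]]
        by (intro linear_compose_sub linear_emp_cross_cov N) (simp add: comp_def)
      show ?thesis
        using linear_norm_bound[OF L1 1, of \<psi>] linear_norm_bound[OF L2 2, of \<psi>] by simp
    qed
    then show "\<exists>A\<in>S.events. 1 - \<epsilon> \<le> S.prob A \<and>
      (\<forall>s\<in>A. \<forall>\<psi>. norm (C\<^sub>N N (\<lambda>i. z i s) \<psi> - C \<psi>) \<le> ?d * (?d * t) / sqrt (real N) * norm \<psi> \<and>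
      norm (D\<^sub>N N (\<lambda>i. z i s) \<psi> - C\<^sub>N N (\<lambda>i. z i s) (U \<psi>)) \<le> ?d * (?d * t) / sqrt (real N) * norm \<psi>)"
      using A(1,2) by blast
  qed
qed

text \<open>For every sample some bound \<open>M\<close> works, so the events that a given \<open>M\<close> works increase to the whole
  space and their probabilities tend to one.\<close>

lemma emp_cov_lower_bound_tight:
  assumes N: "0 < N" and \<epsilon>: "0 < \<epsilon>"
  shows "\<exists>M\<ge>0. \<exists>A\<in>S.events. 1 - \<epsilon> \<le> S.prob A \<and>
    (\<forall>s\<in>A. \<forall>\<psi>\<in>H\<^sub>N N (\<lambda>i. z i s). norm \<psi> \<le> M * norm (C\<^sub>N N (\<lambda>i. z i s) \<psi>))"
proof -
  define g where "g a s = (\<Sum>i<N. a i *\<^sub>R \<Phi> (fst (z i s)))" for a :: "nat \<Rightarrow> real" and s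
  \<comment> \<open>The coefficients are made undefined beyond \<open>N\<close>, for otherwise there are uncountably many.\<close>
  define Q where "Q = PiE {..<N} (\<lambda>_. \<rat> :: real set)"
  define A where "A m = {s \<in> space S. \<forall>a\<in>Q. norm (g a s) \<le> real m * norm (C\<^sub>N N (\<lambda>i. z i s) (g a s))}"
    for m :: nat
  have Q: "countable Q"
    unfolding Q_def by (intro countable_PiE) (auto simp: countable_rat)
  have g_meas [measurable]: "g a \<in> borel_measurable S" for a
    unfolding g_def[abs_def] by measurable
  have Cg_meas [measurable]: "(\<lambda>s. C\<^sub>N N (\<lambda>i. z i s) (g a s)) \<in> borel_measurable S" for a
    unfolding emp_cov_eq by measurable
  have A: "A m \<in> S.events" for m
    unfolding A_def using Q by measurable
  have "incseq A"
  proof (rule incseq_SucI, rule subsetI)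
    fix m s assume "s \<in> A m"
    moreover have "real m * norm x \<le> real (Suc m) * norm x" for x :: 'h
      by (intro mult_right_mono) auto
    ultimately show "s \<in> A (Suc m)"
      unfolding A_def by (blast intro: order_trans)
  qed
  then have lim: "(\<lambda>m. S.prob (A m)) \<longlonglongrightarrow> S.prob (\<Union>m. A m)"
    using A by (intro S.finite_Lim_measure_incseq) auto
  have "s \<in> (\<Union>m. A m)" if s: "s \<in> space S" for s
  proof -
    obtain M where M: "\<And>\<psi>. \<psi> \<in> H\<^sub>N N (\<lambda>i. z i s) \<Longrightarrow> norm \<psi> \<le> M * norm (C\<^sub>N N (\<lambda>i. z i s) \<psi>)"
      using emp_cov_lower_bound_ex[OF N, of "\<lambda>i. z i s"] by blast
    have "norm (g a s) \<le> real (nat \<lceil>M\<rceil>) * norm (C\<^sub>N N (\<lambda>i. z i s) (g a s))" for a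
    proof -
      have "g a s \<in> H\<^sub>N N (\<lambda>i. z i s)"
        unfolding g_def using feature_in_emp_space[OF N]
        by (intro subspace_sum subspace_scale subspace_emp_space N) auto
      then have "norm (g a s) \<le> M * norm (C\<^sub>N N (\<lambda>i. z i s) (g a s))"
        by (rule M)
      also have "\<dots> \<le> real (nat \<lceil>M\<rceil>) * norm (C\<^sub>N N (\<lambda>i. z i s) (g a s))"
        by (intro mult_right_mono real_nat_ceiling_ge) auto
      finally show ?thesis .
    qed
    then show ?thesis
      using s by (auto simp: A_def)
  qed
  then have "(\<Union>m. A m) = space S"
    by (auto simp: A_def)
  then have "(\<lambda>m. S.prob (A m)) \<longlonglongrightarrow> 1"
    using lim by (simp add: S.prob_space)
  then have "\<forall>\<^sub>F m in sequentially. 1 - \<epsilon> < S.prob (A m)"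
    using \<epsilon> by (intro order_tendstoD) auto
  then obtain m where "1 - \<epsilon> < S.prob (A m)"
    by (auto simp: eventually_sequentially)
  moreover have "norm \<psi> \<le> real m * norm (C\<^sub>N N (\<lambda>i. z i s) \<psi>)"
    if "s \<in> A m" "\<psi> \<in> H\<^sub>N N (\<lambda>i. z i s)" for s \<psi>
    by (rule emp_cov_lower_bound_of_rational[OF N _ that(2)])
      (use that(1) in \<open>auto simp: A_def Q_def g_def\<close>)
  ultimately show ?thesis
    using A by (intro exI[of _ "real m"] conjI bexI[of _ "A m"]) auto
qed

definition good_sample :: "real \<Rightarrow> nat \<Rightarrow> (nat \<Rightarrow> 'a \<times> 'a) \<Rightarrow> bool" where
  "good_sample e N y \<longleftrightarrow> (\<forall>\<psi>. norm (U\<^sub>N N y \<psi> - U \<psi>) \<le> e / sqrt (real N) * norm \<psi> \<and>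
    norm (B\<^sub>N N y \<psi> - B \<psi>) \<le> e / sqrt (real N) * norm \<psi>)"

lemma good_sample_mono:
  assumes "good_sample e N y" "e \<le> e'"
  shows "good_sample e' N y"
proof -
  have "e / sqrt (real N) * norm \<psi> \<le> e' / sqrt (real N) * norm \<psi>" for \<psi> :: 'h
    by (intro mult_right_mono divide_right_mono assms(2)) auto
  then show ?thesis
    using assms(1) unfolding good_sample_def by (meson order_trans)
qed

text \<open>The threshold \<open>N0\<close> is where the deviation of \<open>C\<^sup>N\<close> from \<open>C\<close> drops to half of the coercivity
  constant of \<open>C\<close>, which leaves \<open>c1 / 2\<close> for \<open>C\<^sup>N\<close>.\<close>

lemma good_sample_large:
  assumes \<epsilon>: "0 < \<epsilon>"
  shows "\<exists>e\<ge>0. \<exists>N0>0. \<forall>N\<ge>N0. \<exists>A\<in>S.events. 1 - \<epsilon> \<le> S.prob A \<and> (\<forall>s\<in>A. good_sample e N (\<lambda>i. z i s))"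
proof -
  obtain t where t: "t \<ge> 0" "\<And>N. 0 < N \<Longrightarrow> \<exists>A\<in>S.events. 1 - \<epsilon> \<le> S.prob A \<and>
    (\<forall>s\<in>A. \<forall>\<psi>. norm (C\<^sub>N N (\<lambda>i. z i s) \<psi> - C \<psi>) \<le> t / sqrt (real N) * norm \<psi> \<and>
      norm (D\<^sub>N N (\<lambda>i. z i s) \<psi> - C\<^sub>N N (\<lambda>i. z i s) (U \<psi>)) \<le> t / sqrt (real N) * norm \<psi>)"
    using emp_operators_concentration[OF \<epsilon>] by metis
  define N0 where "N0 = nat \<lceil>(2 * t / c1)\<^sup>2\<rceil> + 1"
  have N0: "t / sqrt (real N) \<le> c1 / 2" if "N \<ge> N0" for N
  proof -
    have "(2 * t / c1)\<^sup>2 \<le> real N"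
      using that real_nat_ceiling_ge[of "(2 * t / c1)\<^sup>2"] unfolding N0_def by linarith
    then have "2 * t / c1 \<le> sqrt (real N)"
      by (rule real_le_rsqrt)
    moreover have "0 < sqrt (real N)"
      using that by (simp add: N0_def)
    ultimately show ?thesis
      using c1_pos by (simp add: field_simps)
  qed
  have "\<exists>A\<in>S.events. 1 - \<epsilon> \<le> S.prob A \<and> (\<forall>s\<in>A. good_sample (2 * t / c1) N (\<lambda>i. z i s))"
    if N: "N \<ge> N0" for N
  proof -
    have N': "0 < N"
      using N by (simp add: N0_def)
    from t(2)[OF N'] obtain A where A: "A \<in> S.events" "1 - \<epsilon> \<le> S.prob A"
      "\<And>s \<psi>. s \<in> A \<Longrightarrow> norm (C\<^sub>N N (\<lambda>i. z i s) \<psi> - C \<psi>) \<le> t / sqrt (real N) * norm \<psi>"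
      "\<And>s \<psi>. s \<in> A \<Longrightarrow> norm (D\<^sub>N N (\<lambda>i. z i s) \<psi> - C\<^sub>N N (\<lambda>i. z i s) (U \<psi>)) \<le> t / sqrt (real N) * norm \<psi>"
      by blast
    have "good_sample (2 * t / c1) N (\<lambda>i. z i s)" if s: "s \<in> A" for s
    proof -
      have co: "c1 / 2 * norm \<psi> \<le> norm (C\<^sub>N N (\<lambda>i. z i s) \<psi>)" for \<psi>
      proof -
        have "norm (C \<psi>) - norm (C\<^sub>N N (\<lambda>i. z i s) \<psi>) \<le> norm (C\<^sub>N N (\<lambda>i. z i s) \<psi> - C \<psi>)"
          by (metis norm_minus_commute norm_triangle_ineq2)
        also have "\<dots> \<le> t / sqrt (real N) * norm \<psi>"
          by (rule A(3)[OF s])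
        also have "\<dots> \<le> c1 / 2 * norm \<psi>"
          by (intro mult_right_mono N0 N) auto
        finally show ?thesis
          using coercive[of \<psi>] by simp
      qed
      have c: "0 < c1 / 2"
        using c1_pos by simp
      have "norm (U\<^sub>N N (\<lambda>i. z i s) \<psi> - U \<psi>) \<le> 2 * t / c1 / sqrt (real N) * norm \<psi>" for \<psi>
      proof -
        have "norm (U\<^sub>N N (\<lambda>i. z i s) \<psi> - U \<psi>)
            \<le> norm (D\<^sub>N N (\<lambda>i. z i s) \<psi> - C\<^sub>N N (\<lambda>i. z i s) (U \<psi>)) / (c1 / 2)"
          by (rule emp_koopman_error[OF N' c co])
        also have "\<dots> \<le> t / sqrt (real N) * norm \<psi> / (c1 / 2)"
          using c by (intro divide_right_mono A(4)[OF s]) auto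
        finally show ?thesis
          by (simp add: field_simps)
      qed
      moreover have "norm (B\<^sub>N N (\<lambda>i. z i s) \<psi> - B \<psi>) \<le> 2 * t / c1 / sqrt (real N) * norm \<psi>" for \<psi>
        unfolding emp_lift_back_exact[OF N' c co] using t(1) c1_pos by simp
      ultimately show ?thesis
        by (simp add: good_sample_def)
    qed
    then show ?thesis
      using A(1,2) by blast
  qed
  moreover have "0 \<le> 2 * t / c1" "0 < N0"
    using t(1) c1_pos by (simp_all add: N0_def)
  ultimately show ?thesis by blast
qed

text \<open>No smallness is claimed here: \<open>e\<close> contains the factor \<open>\<surd>N\<close>, and only boundedness of \<open>U\<^sub>N\<close> and
  \<open>B\<^sub>N\<close> is needed.\<close>

lemma good_sample_fixed:
  assumes N: "0 < N" and \<epsilon>: "0 < \<epsilon>"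
  shows "\<exists>e\<ge>0. \<exists>A\<in>S.events. 1 - \<epsilon> \<le> S.prob A \<and> (\<forall>s\<in>A. good_sample e N (\<lambda>i. z i s))"
proof -
  obtain M A where M: "0 \<le> M" and A: "A \<in> S.events" "1 - \<epsilon> \<le> S.prob A"
    "\<And>s \<psi>. s \<in> A \<Longrightarrow> \<psi> \<in> H\<^sub>N N (\<lambda>i. z i s) \<Longrightarrow> norm \<psi> \<le> M * norm (C\<^sub>N N (\<lambda>i. z i s) \<psi>)"
    using emp_cov_lower_bound_tight[OF assms] by blast
  obtain u where u: "0 \<le> u" "\<And>\<psi>. norm (U \<psi>) \<le> u * norm \<psi>"
    using linear_bounded_ex[OF linear_koopman] by blast
  obtain b where b: "0 \<le> b" "\<And>\<psi>. norm (B \<psi>) \<le> b * norm \<psi>"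
    using linear_bounded_ex[OF linear_lift_back] by blast
  define e where "e = max (M * K + u) (sqrt K * M * R + b) * sqrt (real N)"
  have "good_sample e N (\<lambda>i. z i s)" if s: "s \<in> A" for s
    unfolding good_sample_def
  proof (intro allI conjI)
    fix \<psi>
    have e: "e / sqrt (real N) = max (M * K + u) (sqrt K * M * R + b)"
      using N by (simp add: e_def)
    have "norm (U\<^sub>N N (\<lambda>i. z i s) \<psi> - U \<psi>) \<le> norm (U\<^sub>N N (\<lambda>i. z i s) \<psi>) + norm (U \<psi>)"
      by (rule norm_triangle_ineq4)
    also have "\<dots> \<le> M * K * norm \<psi> + u * norm \<psi>"
      by (intro add_mono emp_koopman_norm_le[OF N M A(3)[OF s]] u(2))
    also have "\<dots> \<le> e / sqrt (real N) * norm \<psi>"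
      unfolding e distrib_right[symmetric] by (intro mult_right_mono) auto
    finally show "norm (U\<^sub>N N (\<lambda>i. z i s) \<psi> - U \<psi>) \<le> e / sqrt (real N) * norm \<psi>" .
    have "norm (B\<^sub>N N (\<lambda>i. z i s) \<psi> - B \<psi>) \<le> norm (B\<^sub>N N (\<lambda>i. z i s) \<psi>) + norm (B \<psi>)"
      by (rule norm_triangle_ineq4)
    also have "\<dots> \<le> sqrt K * M * R * norm \<psi> + b * norm \<psi>"
      by (intro add_mono emp_lift_back_norm_le[OF N M A(3)[OF s]] b(2))
    also have "\<dots> \<le> e / sqrt (real N) * norm \<psi>"
      unfolding e distrib_right[symmetric] by (intro mult_right_mono) auto
    finally show "norm (B\<^sub>N N (\<lambda>i. z i s) \<psi> - B \<psi>) \<le> e / sqrt (real N) * norm \<psi>" .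
  qed
  moreover have "0 \<le> e"
    unfolding e_def using M K_pos u(1) by (intro mult_nonneg_nonneg max.coboundedI1) auto
  ultimately show ?thesis
    using A(1,2) by blast
qed

lemma good_sample_uniform:
  assumes \<epsilon>: "0 < \<epsilon>"
  shows "\<exists>e\<ge>0. \<forall>N>0. \<exists>A\<in>S.events. 1 - \<epsilon> \<le> S.prob A \<and> (\<forall>s\<in>A. good_sample e N (\<lambda>i. z i s))"
proof -
  obtain e0 N0 where e0: "0 \<le> e0" "\<And>N. N \<ge> N0 \<Longrightarrow> \<exists>A\<in>S.events. 1 - \<epsilon> \<le> S.prob A \<and>
      (\<forall>s\<in>A. good_sample e0 N (\<lambda>i. z i s))"
    using good_sample_large[OF \<epsilon>] by blast
  have "\<exists>e\<ge>0. 0 < N \<longrightarrow> (\<exists>A\<in>S.events. 1 - \<epsilon> \<le> S.prob A \<and> (\<forall>s\<in>A. good_sample e N (\<lambda>i. z i s)))" for N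
    using good_sample_fixed[of N, OF _ \<epsilon>] by (cases "0 < N") auto
  then obtain e1 where e1: "\<And>N. 0 \<le> e1 N" "\<And>N. 0 < N \<Longrightarrow> \<exists>A\<in>S.events. 1 - \<epsilon> \<le> S.prob A \<and>
      (\<forall>s\<in>A. good_sample (e1 N) N (\<lambda>i. z i s))"
    by metis
  \<comment> \<open>A sum in place of a maximum, which also covers the case of an empty range.\<close>
  define e where "e = e0 + (\<Sum>N<N0. e1 N)"
  have ge: "e0 \<le> e"
    unfolding e_def using e1(1) by (simp add: sum_nonneg)
  have "\<exists>A\<in>S.events. 1 - \<epsilon> \<le> S.prob A \<and> (\<forall>s\<in>A. good_sample e N (\<lambda>i. z i s))" if N: "0 < N" for N
  proof (cases "N \<ge> N0")
    case True
    from e0(2)[OF True] show ?thesis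
      using good_sample_mono[OF _ ge] by blast
  next
    case False
    then have "e1 N \<le> (\<Sum>N<N0. e1 N)"
      by (intro member_le_sum e1) auto
    then have "e1 N \<le> e"
      unfolding e_def using e0(1) by simp
    then show ?thesis
      using e1(2)[OF N] good_sample_mono by blast
  qed
  moreover have "0 \<le> e"
    using ge e0(1) by simp
  ultimately show ?thesis by blast
qed

end

section \<open>Propagation of the operator error along the mean trajectory\<close>

context finite_onb
begin

lemma linear_adjoint:
  fixes T :: "'h \<Rightarrow> 'b::real_inner"
  assumes "linear T"
  shows "linear (adjoint T)"
proof (rule linearI)
  note T = adjoint_inner[OF assms, symmetric]
  show "adjoint T (x + y) = adjoint T x + adjoint T y" for x y
    by (rule vector_eq_ldot[THEN iffD1]) (simp add: inner_add_right T)
  show "adjoint T (c *\<^sub>R x) = c *\<^sub>R adjoint T x" for c x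
    by (rule vector_eq_ldot[THEN iffD1]) (simp add: T)
qed

lemma adjoint_diff:
  fixes T T' :: "'h \<Rightarrow> 'b::real_inner"
  assumes "linear T" "linear T'"
  shows "adjoint (\<lambda>x. T x - T' x) y = adjoint T y - adjoint T' y"
  by (rule vector_eq_ldot[THEN iffD1])
    (simp add: inner_diff_right inner_diff_left linear_compose_sub assms
      adjoint_inner[OF assms(1), symmetric] adjoint_inner[OF assms(2), symmetric]
      adjoint_inner[OF linear_compose_sub[OF assms], symmetric])

text \<open>Telescoping: replacing one factor at a time in the \<open>j\<close>-fold product of adjoints.\<close>

lemma adjoint_power_error:
  fixes T T' :: "'h \<Rightarrow> 'h"
  assumes T: "linear T" and T': "linear T'"
    and T_le: "\<And>x. norm (T x) \<le> \<Lambda> * norm x" and T'_le: "\<And>x. norm (T' x) \<le> \<Lambda> * norm x"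
    and diff: "\<And>x. norm (T x - T' x) \<le> \<eta> * norm x"
    and \<Lambda>: "1 \<le> \<Lambda>" and \<eta>: "0 \<le> \<eta>"
  shows "norm ((adjoint T ^^ j) x) \<le> \<Lambda> ^ j * norm x"
    and "norm ((adjoint T ^^ j) x - (adjoint T' ^^ j) x) \<le> real j * \<Lambda> ^ j * \<eta> * norm x"
proof -
  have power: "norm ((adjoint S ^^ j) x) \<le> \<Lambda> ^ j * norm x"
    if S: "linear S" "\<And>x. norm (S x) \<le> \<Lambda> * norm x" for S :: "'h \<Rightarrow> 'h" and j
  proof (induction j)
    case (Suc j)
    have "norm ((adjoint S ^^ Suc j) x) \<le> \<Lambda> * norm ((adjoint S ^^ j) x)"
      using adjoint_norm_le[OF S] by simp
    also have "\<dots> \<le> \<Lambda> * (\<Lambda> ^ j * norm x)"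
      using \<Lambda> by (intro mult_left_mono Suc) auto
    finally show ?case by simp
  qed simp
  show "norm ((adjoint T ^^ j) x) \<le> \<Lambda> ^ j * norm x"
    by (rule power[OF T T_le])
  show "norm ((adjoint T ^^ j) x - (adjoint T' ^^ j) x) \<le> real j * \<Lambda> ^ j * \<eta> * norm x"
  proof (induction j)
    case (Suc j)
    define a where "a = (adjoint T ^^ j) x"
    define b where "b = (adjoint T' ^^ j) x"
    have d: "norm (adjoint T b - adjoint T' b) \<le> \<eta> * norm b"
      unfolding adjoint_diff[OF T T', symmetric]
      by (rule adjoint_norm_le[OF linear_compose_sub[OF T T'] diff])
    have "norm (adjoint T a - adjoint T' b) = norm (adjoint T (a - b) + (adjoint T b - adjoint T' b))"
      by (simp add: linear_diff[OF linear_adjoint[OF T]])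
    also have "\<dots> \<le> norm (adjoint T (a - b)) + norm (adjoint T b - adjoint T' b)"
      by (rule norm_triangle_ineq)
    also have "\<dots> \<le> \<Lambda> * norm (a - b) + \<eta> * norm b"
      by (intro add_mono d adjoint_norm_le[OF T T_le])
    also have "\<dots> \<le> \<Lambda> * (real j * \<Lambda> ^ j * \<eta> * norm x) + \<eta> * (\<Lambda> ^ j * norm x)"
      using Suc \<Lambda> \<eta> power[OF T' T'_le] by (intro add_mono mult_left_mono) (auto simp: a_def b_def)
    also have "\<eta> * (\<Lambda> ^ j * norm x) \<le> \<eta> * (\<Lambda> ^ Suc j * norm x)"
      using \<Lambda> \<eta> by (intro mult_left_mono mult_right_mono power_increasing) auto
    finally show ?case
      by (simp add: a_def b_def algebra_simps)
  qed simp
qed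

end

context koopman_setting
begin

text \<open>The base \<open>u + e + 1\<close> bounds both \<open>\<parallel>U\<parallel>\<close> and \<open>\<parallel>U\<^sub>N\<parallel>\<close> and is at least one.\<close>

lemma approx_mean_traj_error:
  assumes N: "0 < N" and e: "0 \<le> e"
    and U_err: "\<And>\<psi>. norm (U\<^sub>N N y \<psi> - U \<psi>) \<le> e / sqrt (real N) * norm \<psi>"
    and B_err: "\<And>\<psi>. norm (B\<^sub>N N y \<psi> - B \<psi>) \<le> e / sqrt (real N) * norm \<psi>"
    and u: "0 \<le> u" "\<And>\<psi>. norm (U \<psi>) \<le> u * norm \<psi>"
    and b: "0 \<le> b" "\<And>\<psi>. norm (B \<psi>) \<le> b * norm \<psi>"
  shows "norm (approx_mean_traj X k evl N y x0 j - mean_traj X k evl \<nu> f \<mu> x0 j)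
    \<le> (1 + b * real j) * (u + e + 1) ^ j * e * sqrt K * real N powr (-1/2)"
proof -
  define \<eta> where "\<eta> = e / sqrt (real N)"
  define \<Lambda> where "\<Lambda> = u + e + 1"
  have \<eta>0: "0 \<le> \<eta>" and \<Lambda>1: "1 \<le> \<Lambda>"
    using e u(1) by (auto simp: \<eta>_def \<Lambda>_def)
  have \<eta>e: "\<eta> \<le> e"
  proof -
    have "e * 1 \<le> e * sqrt (real N)"
      using e N by (intro mult_left_mono) auto
    then show ?thesis
      using N by (simp add: \<eta>_def divide_le_eq)
  qed
  have UN_le: "norm (U\<^sub>N N y \<psi>) \<le> \<Lambda> * norm \<psi>" for \<psi>
  proof -
    have "norm (U\<^sub>N N y \<psi>) \<le> norm (U \<psi>) + norm (U\<^sub>N N y \<psi> - U \<psi>)"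
      by (metis add.commute diff_add_cancel norm_triangle_ineq)
    also have "\<dots> \<le> u * norm \<psi> + e * norm \<psi>"
      using u(2) order_trans[OF U_err mult_right_mono[OF \<eta>e[unfolded \<eta>_def] norm_ge_zero]]
      by (intro add_mono)
    also have "\<dots> \<le> \<Lambda> * norm \<psi>"
      by (simp add: \<Lambda>_def distrib_right)
    finally show ?thesis .
  qed
  have U_le: "norm (U \<psi>) \<le> \<Lambda> * norm \<psi>" for \<psi>
    using e by (intro order_trans[OF u(2)] mult_right_mono) (auto simp: \<Lambda>_def)
  note power = adjoint_power_error[OF linear_emp_koopman[OF N] linear_koopman UN_le U_le
      U_err[folded \<eta>_def] \<Lambda>1 \<eta>0, where x = "\<Phi> x0" and j = j]
  define a where "a = (adjoint (U\<^sub>N N y) ^^ j) (\<Phi> x0)"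
  define a' where "a' = (U' ^^ j) (\<Phi> x0)"
  have "norm (B\<^sub>N N y a - B a') = norm ((B\<^sub>N N y a - B a) + B (a - a'))"
    by (simp add: linear_diff[OF linear_lift_back])
  also have "\<dots> \<le> norm (B\<^sub>N N y a - B a) + norm (B (a - a'))"
    by (rule norm_triangle_ineq)
  also have "\<dots> \<le> \<eta> * norm a + b * norm (a - a')"
    using B_err[of a] b(2)[of "a - a'"] by (simp add: \<eta>_def)
  also have "\<dots> \<le> \<eta> * (\<Lambda> ^ j * norm (\<Phi> x0)) + b * (real j * \<Lambda> ^ j * \<eta> * norm (\<Phi> x0))"
    using power \<eta>0 b(1)
    by (intro add_mono mult_left_mono) (auto simp: a_def a'_def koopman_adj_def)
  also have "\<dots> = ((1 + b * real j) * \<Lambda> ^ j * \<eta>) * norm (\<Phi> x0)"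
    by (simp add: algebra_simps)
  also have "\<dots> \<le> ((1 + b * real j) * \<Lambda> ^ j * \<eta>) * sqrt K"
    using b(1) \<Lambda>1 \<eta>0 by (intro mult_left_mono norm_feature) auto
  also have "\<eta> = e * real N powr (-1/2)"
    using N by (simp add: \<eta>_def powr_minus_divide powr_half_sqrt)
  finally show ?thesis
    by (simp add: approx_mean_traj_def mean_traj_def a_def a'_def \<Lambda>_def mult_ac)
qed

end

section \<open>Expectations of the stochastic trajectories\<close>

text \<open>The statement is about the joint law because a functional of the past and a fresh variable take
  values in different types in general. It is obtained from the independence of two blocks of the
  family by mapping each block separately.\<close>

lemma (in prob_space) joint_law_of_history:
  assumes W: "indep_vars (\<lambda>_. M') W I" and A: "A \<subseteq> I" "b \<in> I" "b \<notin> A"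
    and g: "g \<in> measurable (PiM A (\<lambda>_. M')) L"
  shows "distr M (L \<Otimes>\<^sub>M M') (\<lambda>\<omega>. (g (\<lambda>p\<in>A. W p \<omega>), W b \<omega>))
    = distr M L (\<lambda>\<omega>. g (\<lambda>p\<in>A. W p \<omega>)) \<Otimes>\<^sub>M distr M M' (W b)"
proof -
  let ?X = "\<lambda>\<omega>. \<lambda>p\<in>A. W p \<omega>" and ?Y = "\<lambda>\<omega>. \<lambda>p\<in>{b}. W p \<omega>"
  let ?P = "PiM A (\<lambda>_. M')" and ?R = "PiM {b} (\<lambda>_. M')"
  have "indep_var ?P ?X ?R ?Y"
    using A by (intro indep_var_restrict[OF W]) auto
  then have X: "?X \<in> measurable M ?P" and Y: "?Y \<in> measurable M ?R"
    and joint: "distr M ?P ?X \<Otimes>\<^sub>M distr M ?R ?Y = distr M (?P \<Otimes>\<^sub>M ?R) (\<lambda>\<omega>. (?X \<omega>, ?Y \<omega>))"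
    unfolding indep_var_distribution_eq by auto
  have h: "(\<lambda>y. y b) \<in> measurable ?R M'"
    by measurable
  have gd: "g \<in> measurable (distr M ?P ?X) L" and hd: "(\<lambda>y. y b) \<in> measurable (distr M ?R ?Y) M'"
    using g h by simp_all
  have Wb: "distr M M' (W b) = distr (distr M ?R ?Y) M' (\<lambda>y. y b)"
    by (subst distr_distr[OF h Y]) (simp add: comp_def)
  have sf: "sigma_finite_measure (distr (distr M ?R ?Y) M' (\<lambda>y. y b))"
    by (intro prob_space_imp_sigma_finite prob_space.prob_space_distr[OF _ hd] prob_space_distr[OF Y])
  have "distr M L (\<lambda>\<omega>. g (?X \<omega>)) \<Otimes>\<^sub>M distr M M' (W b)
      = distr (distr M ?P ?X) L g \<Otimes>\<^sub>M distr (distr M ?R ?Y) M' (\<lambda>y. y b)"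
    unfolding Wb by (subst distr_distr[OF g X]) (simp add: comp_def)
  also have "\<dots> = distr (distr M ?P ?X \<Otimes>\<^sub>M distr M ?R ?Y) (L \<Otimes>\<^sub>M M') (\<lambda>(x, y). (g x, y b))"
    by (rule pair_measure_distr[OF gd hd sf])
  also have "\<dots> = distr M (L \<Otimes>\<^sub>M M') (\<lambda>\<omega>. (g (?X \<omega>), W b \<omega>))"
    unfolding joint using X Y g by (subst distr_distr) (auto simp: comp_def)
  finally show ?thesis ..
qed

lemma traj_cong: "(\<And>l. l < j \<Longrightarrow> w l = w' l) \<Longrightarrow> traj f x0 w j = traj f x0 w' j"
  by (induction j) auto

text \<open>The embedding at step \<open>j\<close> is a function of the noise of the steps before \<open>j\<close>. Together with
  \<open>approx_emb_measurable\<close>, applied to the coordinates of a product space, this makes it a measurable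
  functional of the past.\<close>

lemma approx_emb_cong:
  assumes "\<And>l i. l < j \<Longrightarrow> i < Nz \<Longrightarrow> wz l i = wz' l i"
  shows "approx_emb X k evl \<nu> f N y x0 Nz wz j = approx_emb X k evl \<nu> f N y x0 Nz wz' j"
  using assms
proof (induction j)
  case (Suc j)
  then have IH: "approx_emb X k evl \<nu> f N y x0 Nz wz j = approx_emb X k evl \<nu> f N y x0 Nz wz' j"
    by simp
  have "approx_noise X k evl \<nu> f Nz (wz j) x = approx_noise X k evl \<nu> f Nz (wz' j) x" for x
    unfolding approx_noise_def using Suc.prems by (auto intro!: sum.cong arg_cong[where f = "scaleR _"])
  then show ?case
    by (simp add: IH)
qed simp

context koopman_setting
begin

text \<open>The Markov property in the form that is used: averaging over a fresh noise value turns \<open>\<psi>\<close> into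
  \<open>U \<psi>\<close>.\<close>

lemma indep_step:
  assumes Q: "prob_space Q"
    and [measurable]: "\<xi> \<in> borel_measurable Q" "w \<in> measurable Q \<nu>"
    and joint: "distr Q (borel \<Otimes>\<^sub>M \<nu>) (\<lambda>\<omega>. (\<xi> \<omega>, w \<omega>)) = distr Q borel \<xi> \<Otimes>\<^sub>M \<nu>"
    and \<xi>X: "AE \<omega> in Q. \<xi> \<omega> \<in> X"
  shows integral_indep_step:
      "(LINT \<omega>|Q. evl \<psi> (f (\<xi> \<omega>) (w \<omega>))) = (LINT \<omega>|Q. evl (U \<psi>) (\<xi> \<omega>))"
    and AE_indep_step_in_X: "AE \<omega> in Q. f (\<xi> \<omega>) (w \<omega>) \<in> X"
proof -
  interpret Q: prob_space Q by (rule Q)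
  let ?P = "distr Q borel \<xi>"
  have P: "prob_space ?P" "sets ?P = sets borel"
    by (auto intro: Q.prob_space_distr)
  have PX: "AE x in ?P. x \<in> X"
    using \<xi>X by (subst AE_distr_iff) auto
  have "(LINT \<omega>|Q. evl \<psi> (f (\<xi> \<omega>) (w \<omega>))) = (LINT p|(?P \<Otimes>\<^sub>M \<nu>). 1 * evl \<psi> (f (fst p) (snd p)))"
    unfolding joint[symmetric] by (subst integral_distr) auto
  also have "\<dots> = (LINT x|?P. 1 * evl (U \<psi>) x)"
    by (rule integral_pair_step[OF P PX]) auto
  also have "\<dots> = (LINT \<omega>|Q. evl (U \<psi>) (\<xi> \<omega>))"
    by (subst integral_distr) auto
  finally show "(LINT \<omega>|Q. evl \<psi> (f (\<xi> \<omega>) (w \<omega>))) = (LINT \<omega>|Q. evl (U \<psi>) (\<xi> \<omega>))" .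
  have "AE p in ?P \<Otimes>\<^sub>M \<nu>. f (fst p) (snd p) \<in> X"
    by (rule AE_pair_step_in_X[OF P PX])
  then show "AE \<omega> in Q. f (\<xi> \<omega>) (w \<omega>) \<in> X"
    unfolding joint[symmetric] by (subst (asm) AE_distr_iff) auto
qed

lemma traj_measurable:
  assumes "\<And>l. l < j \<Longrightarrow> W l \<in> measurable M \<nu>"
  shows "(\<lambda>\<omega>. traj f x0 (\<lambda>l. W l \<omega>) j) \<in> borel_measurable M"
  using assms by (induction j) (auto intro!: dynamics_measurable)

text \<open>By induction \<open>E \<psi>(x\<^sub>j) = \<langle>(U\<^sup>*)\<^sup>j \<Phi>(x\<^sub>0), \<psi>\<rangle>\<close> for all \<open>\<psi>\<close>; the mean is the case of the
  coordinate functions, which represent \<open>B\<close>.\<close>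

lemma traj_expectation:
  assumes Q: "prob_space Q" and w: "prob_space.indep_vars Q (\<lambda>_. \<nu>) w UNIV"
    and w_law: "\<And>j. distr Q \<nu> (w j) = \<nu>" and x0: "x0 \<in> X"
  shows traj_integrable: "integrable Q (\<lambda>\<omega>. traj f x0 (\<lambda>j. w j \<omega>) j)"
    and traj_mean: "(LINT \<omega>|Q. traj f x0 (\<lambda>j. w j \<omega>) j) = mean_traj X k evl \<nu> f \<mu> x0 j"
proof -
  interpret Q: prob_space Q by (rule Q)
  have w_meas [measurable]: "w j \<in> measurable Q \<nu>" for j
    using w unfolding Q.indep_vars_def by blast
  have meas [measurable]: "(\<lambda>\<omega>. traj f x0 (\<lambda>j. w j \<omega>) j) \<in> borel_measurable Q" for j
    by (rule traj_measurable) measurable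
  have step: "distr Q (borel \<Otimes>\<^sub>M \<nu>) (\<lambda>\<omega>. (traj f x0 (\<lambda>l. w l \<omega>) j, w j \<omega>))
      = distr Q borel (\<lambda>\<omega>. traj f x0 (\<lambda>l. w l \<omega>) j) \<Otimes>\<^sub>M \<nu>" for j
  proof -
    have "(\<lambda>y. traj f x0 y j) \<in> borel_measurable (PiM {..<j} (\<lambda>_. \<nu>))"
      using traj_measurable[of j "\<lambda>l y. y l" "PiM {..<j} (\<lambda>_. \<nu>)" x0] by simp
    from Q.joint_law_of_history[OF w _ _ _ this, of j]
    have "distr Q (borel \<Otimes>\<^sub>M \<nu>) (\<lambda>\<omega>. (traj f x0 (\<lambda>p\<in>{..<j}. w p \<omega>) j, w j \<omega>))
      = distr Q borel (\<lambda>\<omega>. traj f x0 (\<lambda>p\<in>{..<j}. w p \<omega>) j) \<Otimes>\<^sub>M \<nu>"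
      by (simp add: w_law)
    moreover have "traj f x0 (\<lambda>p\<in>{..<j}. w p \<omega>) j = traj f x0 (\<lambda>l. w l \<omega>) j" for \<omega>
      by (rule traj_cong) simp
    ultimately show ?thesis by simp
  qed
  have AE_X: "AE \<omega> in Q. traj f x0 (\<lambda>j. w j \<omega>) j \<in> X" for j
  proof (induction j)
    case (Suc j)
    show ?case
      using AE_indep_step_in_X[OF Q meas w_meas step Suc] by simp
  qed (simp add: x0)
  have evl_mean: "(LINT \<omega>|Q. evl \<psi> (traj f x0 (\<lambda>j. w j \<omega>) j)) = (U' ^^ j) (\<Phi> x0) \<bullet> \<psi>" for \<psi> j
  proof (induction j arbitrary: \<psi>)
    case 0
    show ?case
      by (simp add: reproducing[OF x0] Q.prob_space inner_commute)
  next
    case (Suc j)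
    have "(LINT \<omega>|Q. evl \<psi> (traj f x0 (\<lambda>j. w j \<omega>) (Suc j))) = (U' ^^ j) (\<Phi> x0) \<bullet> U \<psi>"
      using integral_indep_step[OF Q meas w_meas step AE_X, of \<psi> j] Suc by simp
    then show ?case
      by (simp add: inner_commute[of _ \<psi>] inner_commute[of _ "U \<psi>"] koopman_adj_inner)
  qed
  show int: "integrable Q (\<lambda>\<omega>. traj f x0 (\<lambda>j. w j \<omega>) j)"
    using AE_X[of j] by (intro Q.integrable_const_bound[where B = R] meas) (auto elim!: eventually_mono intro: norm_le_R)
  show "(LINT \<omega>|Q. traj f x0 (\<lambda>j. w j \<omega>) j) = mean_traj X k evl \<nu> f \<mu> x0 j"
  proof (rule vector_eq_ldot[THEN iffD1], rule allI)
    fix v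
    have "v \<bullet> (LINT \<omega>|Q. traj f x0 (\<lambda>j. w j \<omega>) j) = (LINT \<omega>|Q. v \<bullet> traj f x0 (\<lambda>j. w j \<omega>) j)"
      by (rule integral_inner_right[OF int, symmetric])
    also have "\<dots> = (LINT \<omega>|Q. evl (coord v) (traj f x0 (\<lambda>j. w j \<omega>) j))"
    proof (rule integral_cong_AE)
      show "AE \<omega> in Q. v \<bullet> traj f x0 (\<lambda>j. w j \<omega>) j = evl (coord v) (traj f x0 (\<lambda>j. w j \<omega>) j)"
        using AE_X[of j] by eventually_elim (simp add: evl_coord)
    qed (use meas in measurable)
    finally show "v \<bullet> (LINT \<omega>|Q. traj f x0 (\<lambda>j. w j \<omega>) j) = v \<bullet> mean_traj X k evl \<nu> f \<mu> x0 j"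
      by (simp add: evl_mean mean_traj_def lift_back_inner)
  qed
qed

lemma linear_measurable:
  fixes T :: "'h \<Rightarrow> 'c::{real_normed_vector, second_countable_topology}"
  assumes "linear T" and [measurable]: "g \<in> borel_measurable M"
  shows "(\<lambda>\<omega>. T (g \<omega>)) \<in> borel_measurable M"
proof -
  have "(\<lambda>\<omega>. T (g \<omega>)) = (\<lambda>\<omega>. \<Sum>b\<in>E. (g \<omega> \<bullet> b) *\<^sub>R T b)"
    using linear_expand[OF assms(1)] by blast
  then show ?thesis
    by (simp only:) measurable
qed

lemma linear_koopman_adj: "linear U'"
  unfolding koopman_adj_def by (rule linear_adjoint[OF linear_koopman])

context
  fixes N :: nat and y :: "nat \<Rightarrow> 'a \<times> 'a" and x0 :: 'a and Nz :: nat
  assumes N: "0 < N" and Nz: "0 < Nz"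
begin

abbreviation emb :: "(nat \<Rightarrow> nat \<Rightarrow> 'w) \<Rightarrow> nat \<Rightarrow> 'h" where
  "emb \<equiv> approx_emb X k evl \<nu> f N y x0 Nz"

lemma approx_noise_measurable:
  assumes [measurable]: "\<xi> \<in> borel_measurable M" and "\<And>i. i < Nz \<Longrightarrow> W i \<in> measurable M \<nu>"
  shows "(\<lambda>\<omega>. approx_noise X k evl \<nu> f Nz (\<lambda>i. W i \<omega>) (\<xi> \<omega>)) \<in> borel_measurable M"
proof -
  have "(\<lambda>\<omega>. U' (\<Phi> (\<xi> \<omega>))) \<in> borel_measurable M"
    by (rule linear_measurable[OF linear_koopman_adj]) measurable
  moreover have "(\<lambda>\<omega>. \<Phi> (f (\<xi> \<omega>) (W i \<omega>))) \<in> borel_measurable M" if "i < Nz" for i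
    by (rule measurable_compose[OF dynamics_measurable[OF assms(1) assms(2)[OF that]] feature_measurable])
  ultimately show ?thesis
    unfolding approx_noise_def
    by (intro borel_measurable_scaleR borel_measurable_sum borel_measurable_diff borel_measurable_const) auto
qed

lemma approx_emb_measurable:
  assumes "\<And>l i. l < j \<Longrightarrow> i < Nz \<Longrightarrow> W l i \<in> measurable M \<nu>"
  shows "(\<lambda>\<omega>. emb (\<lambda>l i. W l i \<omega>) j) \<in> borel_measurable M"
  using assms
proof (induction j)
  case (Suc j)
  then have IH: "(\<lambda>\<omega>. emb (\<lambda>l i. W l i \<omega>) j) \<in> borel_measurable M"
    by simp
  have "(\<lambda>\<omega>. approx_noise X k evl \<nu> f Nz (\<lambda>i. W j i \<omega>) (B\<^sub>N N y (emb (\<lambda>l i. W l i \<omega>) j)))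
      \<in> borel_measurable M"
    by (rule approx_noise_measurable[OF linear_measurable[OF linear_emp_lift_back[OF N] IH] Suc.prems]) simp_all
  then show ?case
    unfolding approx_emb.simps
    by (intro borel_measurable_add linear_measurable[OF linear_adjoint[OF linear_emp_koopman[OF N]] IH])
qed simp

text \<open>The bound is sure and not only almost sure, also when the reconstructed state leaves \<open>X\<close>, because
  the feature map is bounded and vanishes outside \<open>X\<close>. It provides all integrability.\<close>

lemma approx_emb_bounded: "\<exists>c. \<forall>wz. norm (emb wz j) \<le> c"
proof (induction j)
  case 0
  show ?case by auto
next
  case (Suc j)
  then obtain c where c: "\<And>wz. norm (emb wz j) \<le> c"
    by blast
  obtain a where a: "0 \<le> a" "\<And>x. norm (adjoint (U\<^sub>N N y) x) \<le> a * norm x"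
    using linear_bounded_ex[OF linear_adjoint[OF linear_emp_koopman[OF N]], of y] by blast
  obtain b where b: "0 \<le> b" "\<And>x. norm (U' x) \<le> b * norm x"
    using linear_bounded_ex[OF linear_koopman_adj] by blast
  have noise: "norm (approx_noise X k evl \<nu> f Nz w x) \<le> sqrt K + b * sqrt K" for w x
    unfolding approx_noise_def
    by (intro norm_average_le[OF Nz] order_trans[OF norm_triangle_ineq4] add_mono norm_feature
        order_trans[OF b(2)] mult_left_mono b(1))
  have "norm (emb wz (Suc j)) \<le> a * c + (sqrt K + b * sqrt K)" for wz
    unfolding approx_emb.simps
    by (intro order_trans[OF norm_triangle_ineq] add_mono noise order_trans[OF a(2)] mult_left_mono c a(1))
  then show ?case by blast
qed

context
  fixes Q :: "'q measure" and wz :: "nat \<Rightarrow> nat \<Rightarrow> 'q \<Rightarrow> 'w"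
  assumes Q: "prob_space Q"
    and wz_indep: "prob_space.indep_vars Q (\<lambda>_. \<nu>) (\<lambda>(j, i). wz j i) (UNIV \<times> {..<Nz})"
    and wz_law: "\<And>j i. i < Nz \<Longrightarrow> distr Q \<nu> (wz j i) = \<nu>"
begin

interpretation Q: prob_space Q by (rule Q)

lemma wz_measurable: "i < Nz \<Longrightarrow> wz j i \<in> measurable Q \<nu>"
  using wz_indep unfolding Q.indep_vars_def by fastforce

abbreviation "rand_emb \<omega> \<equiv> emb (\<lambda>j i. wz j i \<omega>)"

lemma rand_emb_measurable: "(\<lambda>\<omega>. rand_emb \<omega> j) \<in> borel_measurable Q"
  by (rule approx_emb_measurable) (rule wz_measurable)

lemma rand_emb_integrable: "integrable Q (\<lambda>\<omega>. rand_emb \<omega> j)"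
proof -
  obtain c where "\<And>w. norm (emb w j) \<le> c"
    using approx_emb_bounded by blast
  then show ?thesis
    by (intro Q.integrable_const_bound[where B = c] rand_emb_measurable) auto
qed

abbreviation "rand_state \<omega> j \<equiv> B\<^sub>N N y (rand_emb \<omega> j)"

lemma rand_state_measurable: "(\<lambda>\<omega>. rand_state \<omega> j) \<in> borel_measurable Q"
  by (rule linear_measurable[OF linear_emp_lift_back[OF N] rand_emb_measurable])

lemma rand_state_joint_law:
  assumes i: "i < Nz"
  shows "distr Q (borel \<Otimes>\<^sub>M \<nu>) (\<lambda>\<omega>. (rand_state \<omega> j, wz j i \<omega>))
    = distr Q borel (\<lambda>\<omega>. rand_state \<omega> j) \<Otimes>\<^sub>M \<nu>"
proof -
  let ?A = "{..<j} \<times> {..<Nz}"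
  let ?g = "\<lambda>h. B\<^sub>N N y (emb (\<lambda>l i. h (l, i)) j)"
  have "?g \<in> borel_measurable (PiM ?A (\<lambda>_. \<nu>))"
    by (rule linear_measurable[OF linear_emp_lift_back[OF N]], rule approx_emb_measurable) simp
  from Q.joint_law_of_history[OF wz_indep _ _ _ this, of "(j, i)"] i
  have "distr Q (borel \<Otimes>\<^sub>M \<nu>) (\<lambda>\<omega>. (?g (\<lambda>p\<in>?A. (case p of (j, i) \<Rightarrow> wz j i) \<omega>), wz j i \<omega>))
    = distr Q borel (\<lambda>\<omega>. ?g (\<lambda>p\<in>?A. (case p of (j, i) \<Rightarrow> wz j i) \<omega>)) \<Otimes>\<^sub>M \<nu>"
    by (auto simp: wz_law)
  moreover have "?g (\<lambda>p\<in>?A. (case p of (j, i) \<Rightarrow> wz j i) \<omega>) = rand_state \<omega> j" for \<omega>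
    by (intro arg_cong[where f = "B\<^sub>N N y"] approx_emb_cong) simp
  ultimately show ?thesis by simp
qed

text \<open>Conditionally on the past the noise has mean zero, so in expectation only \<open>U\<^sub>N\<^sup>*\<close> acts.\<close>

lemma rand_emb_mean:
  assumes "\<And>l. l < j \<Longrightarrow> AE \<omega> in Q. rand_state \<omega> l \<in> X"
  shows "(LINT \<omega>|Q. rand_emb \<omega> j \<bullet> \<psi>) = (adjoint (U\<^sub>N N y) ^^ j) (\<Phi> x0) \<bullet> \<psi>"
  using assms
proof (induction j arbitrary: \<psi>)
  case 0
  show ?case by (simp add: Q.prob_space)
next
  case (Suc j)
  let ?\<xi> = "\<lambda>\<omega>. rand_state \<omega> j"
  let ?U = "U\<^sub>N N y"
  have X: "AE \<omega> in Q. ?\<xi> \<omega> \<in> X"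
    using Suc.prems by simp
  note \<xi>_meas [measurable] = rand_state_measurable[of j]
  define noise where "noise i \<omega> = evl \<psi> (f (?\<xi> \<omega>) (wz j i \<omega>)) - evl (U \<psi>) (?\<xi> \<omega>)" for i \<omega>
  \<comment> \<open>Only here does it matter that the reconstructed state lies in \<open>X\<close>: outside, \<open>\<Phi>\<close> vanishes but
    the next state need not leave \<open>X\<close>, and the noise would not be centred.\<close>
  have noise: "integrable Q (noise i)" "(LINT \<omega>|Q. noise i \<omega>) = 0" if i: "i < Nz" for i
  proof -
    note [measurable] = wz_measurable[OF i, of j]
    have 1: "integrable Q (\<lambda>\<omega>. evl \<psi> (f (?\<xi> \<omega>) (wz j i \<omega>)))"
      by (rule Q.integrable_const_bound[where B = "sqrt K * norm \<psi>"]) (auto intro: abs_evl_le)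
    have 2: "integrable Q (\<lambda>\<omega>. evl (U \<psi>) (?\<xi> \<omega>))"
      by (rule Q.integrable_const_bound[where B = "sqrt K * norm (U \<psi>)"]) (auto intro: abs_evl_le)
    show "integrable Q (noise i)"
      unfolding noise_def[abs_def] using 1 2 by (rule Bochner_Integration.integrable_diff)
    show "(LINT \<omega>|Q. noise i \<omega>) = 0"
      unfolding noise_def Bochner_Integration.integral_diff[OF 1 2]
      using integral_indep_step[OF Q \<xi>_meas wz_measurable[OF i] rand_state_joint_law[OF i] X] by simp
  qed
  have emb_int: "integrable Q (\<lambda>\<omega>. rand_emb \<omega> j \<bullet> ?U \<psi>)"
    by (intro integrable_inner_left) (rule rand_emb_integrable)
  have noise_int: "integrable Q (\<lambda>\<omega>. (1 / real Nz) * (\<Sum>i<Nz. noise i \<omega>))"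
    by (intro integrable_mult_right Bochner_Integration.integrable_sum noise) auto
  have adj: "adjoint ?U x \<bullet> \<psi> = x \<bullet> ?U \<psi>" for x
    using adjoint_inner[OF linear_emp_koopman[OF N], of y \<psi> x] by (simp add: inner_commute)
  have noise_eq: "approx_noise X k evl \<nu> f Nz (\<lambda>i. wz j i \<omega>) (?\<xi> \<omega>) \<bullet> \<psi> = (1 / real Nz) * (\<Sum>i<Nz. noise i \<omega>)"
    for \<omega>
  proof -
    have "(\<Phi> a - U' (\<Phi> b)) \<bullet> \<psi> = evl \<psi> a - evl (U \<psi>) b" for a b
      using evl_inner[of \<psi> a] evl_inner[of "U \<psi>" b] koopman_adj_inner[of \<psi> "\<Phi> b"]
        inner_commute[of \<psi> "\<Phi> a"] inner_commute[of \<psi> "U' (\<Phi> b)"]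
      unfolding inner_diff_left by linarith
    then show ?thesis
      unfolding approx_noise_def noise_def by (simp add: inner_sum_left)
  qed
  have "(LINT \<omega>|Q. rand_emb \<omega> (Suc j) \<bullet> \<psi>)
      = (LINT \<omega>|Q. rand_emb \<omega> j \<bullet> ?U \<psi> + (1 / real Nz) * (\<Sum>i<Nz. noise i \<omega>))"
    by (simp only: approx_emb.simps inner_add_left adj noise_eq)
  also have "\<dots> = (LINT \<omega>|Q. rand_emb \<omega> j \<bullet> ?U \<psi>) + (LINT \<omega>|Q. (1 / real Nz) * (\<Sum>i<Nz. noise i \<omega>))"
    by (rule Bochner_Integration.integral_add[OF emb_int noise_int])
  also have "(LINT \<omega>|Q. (1 / real Nz) * (\<Sum>i<Nz. noise i \<omega>)) = 0"
    using noise by (simp add: Bochner_Integration.integral_sum)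
  also have "(LINT \<omega>|Q. rand_emb \<omega> j \<bullet> ?U \<psi>) = (adjoint ?U ^^ j) (\<Phi> x0) \<bullet> ?U \<psi>"
    using Suc.prems by (intro Suc.IH) simp
  finally show ?case
    by (simp add: adj)
qed

lemma approx_traj_mean:
  assumes "\<And>l. l < j \<Longrightarrow> AE \<omega> in Q. approx_traj X k evl \<nu> f N y x0 Nz (\<lambda>j i. wz j i \<omega>) l \<in> X"
  shows approx_traj_integrable: "integrable Q (\<lambda>\<omega>. approx_traj X k evl \<nu> f N y x0 Nz (\<lambda>j i. wz j i \<omega>) j)"
    and approx_traj_expectation: "(LINT \<omega>|Q. approx_traj X k evl \<nu> f N y x0 Nz (\<lambda>j i. wz j i \<omega>) j)
      = approx_mean_traj X k evl N y x0 j"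
proof -
  obtain b where b: "0 \<le> b" "\<And>x. norm (B\<^sub>N N y x) \<le> b * norm x"
    using linear_bounded_ex[OF linear_emp_lift_back[OF N], of y] by blast
  obtain c where c: "\<And>w. norm (emb w j) \<le> c"
    using approx_emb_bounded by blast
  have "norm (rand_state \<omega> j) \<le> b * c" for \<omega>
    by (intro order_trans[OF b(2)] mult_left_mono c b(1))
  then have int: "integrable Q (\<lambda>\<omega>. rand_state \<omega> j)"
    by (intro Q.integrable_const_bound[where B = "b * c"] rand_state_measurable) auto
  then show "integrable Q (\<lambda>\<omega>. approx_traj X k evl \<nu> f N y x0 Nz (\<lambda>j i. wz j i \<omega>) j)"
    by (simp add: approx_traj_def)
  show "(LINT \<omega>|Q. approx_traj X k evl \<nu> f N y x0 Nz (\<lambda>j i. wz j i \<omega>) j) = approx_mean_traj X k evl N y x0 j"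
    unfolding approx_traj_def approx_mean_traj_def
  proof (rule vector_eq_rdot[THEN iffD1], rule allI)
    fix v
    note B = adjoint_inner[OF linear_emp_lift_back[OF N]]
    have "(LINT \<omega>|Q. rand_state \<omega> j) \<bullet> v = (LINT \<omega>|Q. rand_state \<omega> j \<bullet> v)"
      by (rule integral_inner_left[OF int, symmetric])
    also have "\<dots> = (adjoint (U\<^sub>N N y) ^^ j) (\<Phi> x0) \<bullet> adjoint (B\<^sub>N N y) v"
      using assms unfolding B by (intro rand_emb_mean) (simp add: approx_traj_def)
    finally show "(LINT \<omega>|Q. rand_state \<omega> j) \<bullet> v = B\<^sub>N N y ((adjoint (U\<^sub>N N y) ^^ j) (\<Phi> x0)) \<bullet> v"
      unfolding B .
  qed
qed

end

end

end

theorem theorem7: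
  fixes X :: "(real ^ 'n) set"
    and \<nu> :: "'w measure"
    and f :: "real ^ 'n \<Rightarrow> 'w \<Rightarrow> real ^ 'n"
    and \<mu> :: "(real ^ 'n) measure"
    and k :: "real ^ 'n \<Rightarrow> real ^ 'n \<Rightarrow> real"
    and evl :: "'h::{real_inner, banach, second_countable_topology} \<Rightarrow> real ^ 'n \<Rightarrow> real"
    and c1 \<delta> :: real
    and x0 :: "real ^ 'n"
    and S :: "'s measure"
    and z :: "nat \<Rightarrow> 's \<Rightarrow> (real ^ 'n) \<times> (real ^ 'n)"
    and Q :: "'q measure"
    and w :: "nat \<Rightarrow> 'q \<Rightarrow> 'w"
    and Nz :: nat
    and wz :: "nat \<Rightarrow> nat \<Rightarrow> 'q \<Rightarrow> 'w"
  assumes noise_law: "prob_space \<nu>"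
    and dynamics: "(\<lambda>(x, u). f x u) \<in> borel_measurable (borel \<Otimes>\<^sub>M \<nu>)"
    and compact: "compact X"
    and invariant: "\<forall>x\<in>X. measure (transition \<nu> f x) X = 1"
    and mu: "prob_space \<mu>" "sets \<mu> = sets borel" "measure \<mu> X = 1"
    and kernel: "pos_def_kernel X k"
    and kernel_bounded: "bounded ((\<lambda>p. k (fst p) (snd p)) ` (X \<times> X))"
    and kernel_measurable:
      "(\<lambda>p. k (fst p) (snd p)) \<in> borel_measurable (restrict_space borel (X \<times> X))"
    and rkhs: "rkhs X k evl"
    and coercive: "c1 > 0" "\<forall>\<psi>. c1 * norm \<psi> \<le> norm (cov X k evl \<mu> \<psi>)"
    and koopman_invariant: "\<forall>g \<in> range evl. koopman_fun X \<nu> f g \<in> range evl"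
    and lift_back_adj: "range (lift_back_adj_fun X) \<subseteq> range evl"
    and x0: "x0 \<in> X"
    and sample: "prob_space S" "prob_space.indep_vars S (\<lambda>_. borel) z UNIV"
      "\<forall>i. distr S borel (z i) = sample_law \<nu> f \<mu>"
    and noise: "prob_space Q"
    and traj_noise: "prob_space.indep_vars Q (\<lambda>_. \<nu>) w UNIV"
      "\<forall>j. distr Q \<nu> (w j) = \<nu>"
    and Nz: "Nz > 0"
    and approx_noise: "prob_space.indep_vars Q (\<lambda>_. \<nu>) (\<lambda>(j, i). wz j i) (UNIV \<times> {..<Nz})"
      "\<forall>j. \<forall>i<Nz. distr Q \<nu> (wz j i) = \<nu>"
    and delta: "0 < \<delta>" "\<delta> < 1"
  shows "\<exists>C :: nat \<Rightarrow> real. \<forall>N :: nat.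
    \<delta> > 2 * exp (- (real N * c1\<^sup>2 / (8 * kernel_sup X k))) \<longrightarrow>
    (\<exists>A \<in> sets S. measure S A \<ge> (1 - \<delta>) ^ 3 \<and>
      (\<forall>s\<in>A. \<forall>j.
        norm (approx_mean_traj X k evl N (\<lambda>i. z i s) x0 j - mean_traj X k evl \<nu> f \<mu> x0 j)
          \<le> C j * real N powr (-1/2) \<and>
        ((\<forall>l<j. AE \<omega> in Q.
            approx_traj X k evl \<nu> f N (\<lambda>i. z i s) x0 Nz (\<lambda>j i. wz j i \<omega>) l \<in> X) \<longrightarrow>
          norm (LINT \<omega>|Q. approx_traj X k evl \<nu> f N (\<lambda>i. z i s) x0 Nz (\<lambda>j i. wz j i \<omega>) j
                           - traj f x0 (\<lambda>j. w j \<omega>) j)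
            \<le> C j * real N powr (-1/2))))"
proof -
  obtain a where a: "\<forall>x\<in>X. \<forall>y\<in>X. \<bar>k x y\<bar> \<le> a"
    using kernel_bounded unfolding bounded_iff by auto
  define K where "K = \<bar>a\<bar> + 1"
  have K0: "0 < K"
    by (simp add: K_def)
  have K: "k x x \<le> K" if "x \<in> X" for x
  proof -
    have "\<bar>k x x\<bar> \<le> a"
      using a that by blast
    then show ?thesis
      by (simp add: K_def)
  qed
  obtain r where r: "\<And>x. x \<in> X \<Longrightarrow> norm x \<le> r"
    using compact_imp_bounded[OF compact] unfolding bounded_iff by blast
  define R where "R = \<bar>r\<bar>"
  have R: "0 \<le> R" "\<And>x. x \<in> X \<Longrightarrow> norm x \<le> R"
    using order_trans[OF r abs_ge_self] by (auto simp: R_def)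
  have X_borel: "X \<in> sets borel"
    using compact by (simp add: compact_imp_closed)
  interpret ck: coercive_kernel X k evl K \<mu> c1
  proof (intro coercive_kernel.intro kernel_space.intro coercive_kernel_axioms.intro)
    show "c1 * norm \<psi> \<le> norm (cov X k evl \<mu> \<psi>)" for \<psi>
      using coercive(2) by blast
  qed (fact rkhs K0 K mu(1,2) coercive(1))+
  obtain E :: "'h set" where "finite_onb E"
    using ck.ex_finite_onb by blast
  then interpret onb: finite_onb E .
  interpret ks: koopman_sampling X k evl K E \<mu> c1 \<nu> f R S z
  proof (intro koopman_sampling.intro koopman_setting.intro fd_kernel_space.intro
      fd_kernel_space_axioms.intro koopman_setting_axioms.intro koopman_sampling_axioms.intro)
    show "koopman_fun X \<nu> f (evl \<psi>) \<in> range evl" for \<psi>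
      using koopman_invariant by blast
    show "lift_back_adj_fun X v \<in> range evl" for v
      using lift_back_adj by blast
    show "measure (transition \<nu> f x) X = 1" if "x \<in> X" for x
      using invariant that by blast
    show "distr S borel (z i) = sample_law \<nu> f \<mu>" for i
      using sample(3) by blast
  qed (fact ck.kernel_space_axioms onb.finite_onb_axioms ck.coercive_kernel_axioms
      X_borel kernel_measurable noise_law dynamics mu(3) R sample(1,2))+
  obtain e where e: "0 \<le> e" "\<And>N. 0 < N \<Longrightarrow> \<exists>A\<in>sets S. 1 - \<delta> \<le> measure S A \<and>
      (\<forall>s\<in>A. ks.good_sample e N (\<lambda>i. z i s))"
    using ks.good_sample_uniform[OF delta(1)] by blast
  obtain u where u: "0 \<le> u" "\<And>\<psi>. norm (ks.U \<psi>) \<le> u * norm \<psi>"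
    using onb.linear_bounded_ex[OF ks.linear_koopman] by blast
  obtain b where b: "0 \<le> b" "\<And>\<psi>. norm (ks.B \<psi>) \<le> b * norm \<psi>"
    using onb.linear_bounded_ex[OF ks.linear_lift_back] by blast
  define C where "C j = (1 + b * real j) * (u + e + 1) ^ j * e * sqrt K" for j :: nat
  show ?thesis
  proof (intro exI[of _ C] allI impI)
    fix N :: nat
    assume N_large: "\<delta> > 2 * exp (- (real N * c1\<^sup>2 / (8 * kernel_sup X k)))"
    \<comment> \<open>For \<open>N = 0\<close> the lower bound on \<open>\<delta>\<close> would be \<open>2\<close>.\<close>
    have N: "0 < N"
    proof (rule ccontr)
      assume "\<not> 0 < N"
      then show False
        using N_large delta(2) by simp
    qed
    from e(2)[OF N] obtain A where A: "A \<in> sets S" "1 - \<delta> \<le> measure S A"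
      "\<And>s. s \<in> A \<Longrightarrow> ks.good_sample e N (\<lambda>i. z i s)"
      by blast
    have "(1 - \<delta>) ^ 3 \<le> (1 - \<delta>) ^ 1"
      using delta by (intro power_decreasing) auto
    then have prob_A: "(1 - \<delta>) ^ 3 \<le> measure S A"
      using A(2) by simp
    have mean_error: "norm (approx_mean_traj X k evl N (\<lambda>i. z i s) x0 j - mean_traj X k evl \<nu> f \<mu> x0 j)
        \<le> C j * real N powr (-1/2)" if "s \<in> A" for s j
      using A(3)[OF that] unfolding C_def ks.good_sample_def
      by (intro ks.approx_mean_traj_error[OF N e(1) _ _ u b]) auto
    have "norm (LINT \<omega>|Q. approx_traj X k evl \<nu> f N (\<lambda>i. z i s) x0 Nz (\<lambda>j i. wz j i \<omega>) j
                           - traj f x0 (\<lambda>j. w j \<omega>) j) \<le> C j * real N powr (-1/2)"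
      if s: "s \<in> A" and X: "\<forall>l<j. AE \<omega> in Q.
            approx_traj X k evl \<nu> f N (\<lambda>i. z i s) x0 Nz (\<lambda>j i. wz j i \<omega>) l \<in> X" for s j
    proof -
      have wz_law: "distr Q \<nu> (wz l i) = \<nu>" if "i < Nz" for l i
        using approx_noise(2) that by blast
      have w_law: "distr Q \<nu> (w l) = \<nu>" for l
        using traj_noise(2) by blast
      have X': "AE \<omega> in Q. approx_traj X k evl \<nu> f N (\<lambda>i. z i s) x0 Nz (\<lambda>j i. wz j i \<omega>) l \<in> X"
        if "l < j" for l
        using X that by blast
      note approx = ks.approx_traj_mean[OF N Nz noise approx_noise(1) wz_law X']
      note true = ks.traj_integrable[OF noise traj_noise(1) w_law x0]
        ks.traj_mean[OF noise traj_noise(1) w_law x0]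
      have "(LINT \<omega>|Q. approx_traj X k evl \<nu> f N (\<lambda>i. z i s) x0 Nz (\<lambda>j i. wz j i \<omega>) j
                           - traj f x0 (\<lambda>j. w j \<omega>) j)
          = approx_mean_traj X k evl N (\<lambda>i. z i s) x0 j - mean_traj X k evl \<nu> f \<mu> x0 j"
        by (simp only: Bochner_Integration.integral_diff[OF approx(1) true(1)] approx(2) true(2))
      then show ?thesis
        using mean_error[OF s] by simp
    qed
    then show "\<exists>A \<in> sets S. measure S A \<ge> (1 - \<delta>) ^ 3 \<and>
      (\<forall>s\<in>A. \<forall>j.
        norm (approx_mean_traj X k evl N (\<lambda>i. z i s) x0 j - mean_traj X k evl \<nu> f \<mu> x0 j)
          \<le> C j * real N powr (-1/2) \<and>
        ((\<forall>l<j. AE \<omega> in Q.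
            approx_traj X k evl \<nu> f N (\<lambda>i. z i s) x0 Nz (\<lambda>j i. wz j i \<omega>) l \<in> X) \<longrightarrow>
          norm (LINT \<omega>|Q. approx_traj X k evl \<nu> f N (\<lambda>i. z i s) x0 Nz (\<lambda>j i. wz j i \<omega>) j
                           - traj f x0 (\<lambda>j. w j \<omega>) j)
            \<le> C j * real N powr (-1/2)))"
      using A(1) prob_A mean_error by blast
  qed
qed

end
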